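(* Let $(a_0,a_1)\in\mathbb{Z}^2$ with $\max\{|a_0|,|a_1|\}\le 10$ and let $\lambda\in\,]-2,2[$. Then the integer sequence $(a_n)_{n\ge 0}$ determined by the initial values $a_0,a_1$ and the condition $$0\le a_{n+2}+\lambda a_{n+1}+a_n<1\qquad(n\ge 0)$$ is periodic.
   Context: For real $\lambda$ and integers $a_n,a_{n+1}$, the condition $0\le a_{n+2}+\lambda a_{n+1}+a_n<1$ with $a_{n+2}\in\mathbb{Z}$ determines $a_{n+2}$ uniquely, namely $a_{n+2}=-\lfloor \lambda a_{n+1}+a_n\rfloor$. *)

theory Defs imports Complex_Main
begin

end

theory Submission imports Defs
begin

text \<open>The map \<open>(a\<^sub>n, a\<^sub>n\<^sub>+\<^sub>1) \<mapsto> (a\<^sub>n\<^sub>+\<^sub>1, a\<^sub>n\<^sub>+\<^sub>2)\<close> is conjugate to its inverse by swapping coordinates. Hence an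
  orbit is periodic as soon as it reaches a periodic pair, or if it has two distinct centres of
  symmetry, i.e. places where it reads \<open>x x\<close> or \<open>x y x\<close>.

  Put \<open>\<mu> = \<lambda> + 2\<close>. The second difference of the sequence is \<open>-\<lfloor>\<mu> a\<^sub>n\<rfloor>\<close>. If \<open>\<mu> \<le> 1/240\<close>, it only takes the
  values \<open>0, 1, -1\<close> on the orbits in question, so that the first difference changes by steps of one and
  vanishes at the top and at the bottom of the orbit, which yields two centres.

  If \<open>1/240 < \<mu> < 4\<close>, the orbits are bounded by 440 and \<open>\<lfloor>\<mu> w\<rfloor>\<close> jumps only at fractions with denominator
  \<open>w\<close>. The interval is cut into finitely many pieces, and on each piece the orbit of every initial pair
  is followed, branching whenever \<open>\<mu>\<close> has to be compared with a fraction, until it returns to its start,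
  meets a lexicographically smaller initial pair, or has shown a centre in both directions of time.
  This finite computation is carried out by rewriting.\<close>

subsection \<open>Reversibility\<close>

definition step :: "real \<Rightarrow> int \<times> int \<Rightarrow> int \<times> int" where
  "step l s = (snd s, - fst s - \<lfloor>l * of_int (snd s)\<rfloor>)"

definition periodic_state :: "real \<Rightarrow> int \<times> int \<Rightarrow> bool" where
  "periodic_state l s \<longleftrightarrow> (\<exists>p>0. (step l ^^ p) s = s)"

text \<open>With \<open>t = (x, y)\<close> the first alternative is the pattern x y x. The pattern x
  x is read off \<open>step l t\<close> rather than \<open>t\<close>, so that even
  \<open>n = 0\<close> gives a reflection after a positive number of steps.\<close>

definition centred :: "real \<Rightarrow> int \<times> int \<Rightarrow> bool" where
  "centred l s \<longleftrightarrow> (\<exists>n. let t = (step l ^^ n) s in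
     step l t = prod.swap t \<or> prod.swap (step l t) = step l t)"

text \<open>The recurrence \<open>a(n) + a(n+2) = - floor (l * a(n+1))\<close> is symmetric in its
  outer terms, so a reversed orbit is again an orbit.\<close>

lemma step_swap_step: "step l (prod.swap (step l s)) = prod.swap s"
  by (simp add: step_def prod_eq_iff)

lemma funpow_step_swap: "(step l ^^ n) (prod.swap ((step l ^^ n) s)) = prod.swap s"
proof (induction n arbitrary: s)
  case (Suc n)
  have "(step l ^^ Suc n) (prod.swap ((step l ^^ Suc n) s))
      = step l ((step l ^^ n) (prod.swap ((step l ^^ n) (step l s))))"
    by (simp add: funpow_swap1)
  also have "\<dots> = prod.swap s"
    by (simp add: Suc.IH step_swap_step)
  finally show ?case .
qed simp

lemma inj_step: "inj (step l)"
  by (rule injI) (metis step_swap_step prod.swap_def surjective_pairing swap_swap)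

text \<open>From a centre after \<open>n\<close> steps the mirrored orbit runs the same steps back
  by \<open>funpow_step_swap\<close>; the two halves add up to \<open>2n + 1\<close> or
  \<open>2n + 2\<close> steps.\<close>

lemma centred_imp_reflection:
  assumes "centred l s"
  shows "\<exists>c>0. (step l ^^ c) s = prod.swap s"
proof -
  obtain n where n: "step l ((step l ^^ n) s) = prod.swap ((step l ^^ n) s) \<or>
     prod.swap (step l ((step l ^^ n) s)) = step l ((step l ^^ n) s)"
    using assms by (auto simp: centred_def Let_def)
  from n show ?thesis
  proof
    assume "step l ((step l ^^ n) s) = prod.swap ((step l ^^ n) s)"
    then have "(step l ^^ n) ((step l ^^ Suc n) s) = prod.swap s"
      using funpow_step_swap[of n l s] by simp
    then have "(step l ^^ (n + Suc n)) s = prod.swap s"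
      by (simp only: funpow_add o_apply)
    then show ?thesis by blast
  next
    assume "prod.swap (step l ((step l ^^ n) s)) = step l ((step l ^^ n) s)"
    then have "(step l ^^ Suc n) ((step l ^^ Suc n) s) = prod.swap s"
      using funpow_step_swap[of "Suc n" l s] by simp
    then have "(step l ^^ (Suc n + Suc n)) s = prod.swap s"
      by (simp only: funpow_add o_apply)
    then show ?thesis by blast
  qed
qed

lemma centred_step: "centred l (step l s) \<Longrightarrow> centred l s"
  unfolding centred_def Let_def by (metis funpow_Suc_right o_apply)

text \<open>Since \<open>step l\<close> is injective, the \<open>n\<close> leading steps can be
  cancelled.\<close>

lemma periodic_of_funpow:
  assumes "periodic_state l ((step l ^^ n) s)"
  shows "periodic_state l s"
proof -
  obtain p where p: "p > 0" "(step l ^^ p) ((step l ^^ n) s) = (step l ^^ n) s"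
    using assms by (auto simp: periodic_state_def)
  then have "(step l ^^ n) ((step l ^^ p) s) = (step l ^^ n) s"
    by (metis add.commute funpow_add o_apply)
  then have "(step l ^^ p) s = s"
    using inj_fn[OF inj_step] by (metis injD)
  then show ?thesis using p(1) by (auto simp: periodic_state_def)
qed

lemma periodic_swap:
  assumes "periodic_state l (prod.swap s)"
  shows "periodic_state l s"
proof -
  obtain p where p: "p > 0" "(step l ^^ p) (prod.swap s) = prod.swap s"
    using assms by (auto simp: periodic_state_def)
  have "(step l ^^ p) s = s"
    using funpow_step_swap[of p l "prod.swap s"] p(2) by simp
  then show ?thesis using p(1) by (auto simp: periodic_state_def)
qed

text \<open>Two reflections compose to a translation along the orbit, here by \<open>d + c\<close>
  steps.\<close>

lemma periodic_of_reflections: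
  assumes "(step l ^^ c) s = prod.swap s" "(step l ^^ d) (prod.swap s) = s" "c > 0 \<or> d > 0"
  shows "periodic_state l s"
proof -
  have "(step l ^^ (d + c)) s = s"
    using assms(1,2) by (simp add: funpow_add)
  then show ?thesis using assms(3) by (auto simp: periodic_state_def intro!: exI[of _ "d + c"])
qed

lemma periodic_of_centred:
  assumes "centred l s" "centred l (prod.swap s)"
  shows "periodic_state l s"
  using centred_imp_reflection[OF assms(1)] centred_imp_reflection[OF assms(2)]
    periodic_of_reflections[of _ l s] by auto

subsection \<open>Values of \<open>\<lambda>\<close> close to \<open>-2\<close>\<close>

context
  fixes e :: real
  assumes e_pos: "0 < e" and e_small: "e * 240 \<le> 1"
begin

lemma step_near: "step (e - 2) (x, y) = (y, 2 * y - x - \<lfloor>e * of_int y\<rfloor>)"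
proof -
  have "(e - 2) * of_int y = e * of_int y - of_int (2 * y)"
    by (simp add: algebra_simps)
  then have "\<lfloor>(e - 2) * of_int y\<rfloor> = \<lfloor>e * of_int y\<rfloor> - 2 * y"
    by (simp only: floor_diff_of_int)
  then show ?thesis by (simp add: step_def)
qed

lemma floor_zero: "0 \<le> y \<Longrightarrow> e * of_int y < 1 \<Longrightarrow> \<lfloor>e * of_int y\<rfloor> = 0"
  using e_pos by (simp add: floor_eq_iff)

lemma floor_minus_one:
  assumes "y < 0" "-240 \<le> y" shows "\<lfloor>e * of_int y\<rfloor> = -1"
proof -
  have "e * of_int y \<ge> e * (-240)" using assms e_pos by (intro mult_left_mono) auto
  moreover have "e * of_int y < 0" using assms e_pos by (simp add: mult_pos_neg)
  ultimately show ?thesis using e_small by (simp add: floor_eq_iff)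
qed

lemma floor_one: "1 \<le> e * of_int y \<Longrightarrow> e * of_int y < 2 \<Longrightarrow> \<lfloor>e * of_int y\<rfloor> = 1"
  by (simp add: floor_eq_iff)

lemma centred_now:
  assumes "2 * y - x - \<lfloor>e * of_int y\<rfloor> = y"
  shows "centred (e - 2) (x, y)"
  unfolding centred_def by (rule exI[of _ 0]) (simp add: step_near assms)

lemma centred_next:
  assumes "centred (e - 2) (y, 2 * y - x - \<lfloor>e * of_int y\<rfloor>)"
  shows "centred (e - 2) (x, y)"
  by (rule centred_step) (simp add: step_near assms)

text \<open>Above \<open>1/e\<close> the slope decreases by one in each step, so it passes through \<open>0\<close>.\<close>

lemma centred_top:
  assumes "1 \<le> e * of_int y" "e * (of_int y + of_nat v * (of_nat v + 1) / 2) < 2"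
  shows "centred (e - 2) (y - int v - 1, y)"
  using assms
proof (induction v arbitrary: y)
  case 0
  then show ?case by (intro centred_now) (simp add: floor_one)
next
  case (Suc v)
  have nn: "0 \<le> e * (of_nat (Suc v) * (of_nat (Suc v) + 1) / 2)"
    using e_pos by simp
  have "e * of_int y < 2" using Suc.prems(2) nn by (simp only: distrib_left)
  then have f: "\<lfloor>e * of_int y\<rfloor> = 1" using Suc.prems(1) by (simp add: floor_one)
  have "e * of_int y \<le> e * of_int (y + int (Suc v))"
    using e_pos by (intro mult_left_mono) auto
  then have "1 \<le> e * of_int (y + int (Suc v))"
    using Suc.prems(1) by linarith
  \<comment> \<open>The height of the peak is invariant: \<open>y\<close> gains
    \<open>v + 1\<close>, and the remaining climb drops from \<open>(v + 1) (v + 2) / 2\<close> to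
    \<open>v (v + 1) / 2\<close>.\<close>
  moreover have "e * (of_int (y + int (Suc v)) + of_nat v * (of_nat v + 1) / 2) < 2"
    using Suc.prems(2) by (simp add: algebra_simps add_divide_distrib)
  ultimately have "centred (e - 2) (y + int (Suc v) - int v - 1, y + int (Suc v))"
    by (rule Suc.IH)
  then show ?case by - (rule centred_next, simp add: f algebra_simps)
qed

text \<open>Between 0 and \<open>1/e\<close> the floor is 0 and the orbit climbs in equal steps
  \<open>v\<close>. The last hypothesis says that the preceding term is still below
  \<open>1/e\<close>, which limits the height at which \<open>centred_top\<close> takes
  over.\<close>

lemma centred_up:
  assumes "0 \<le> y" "1 \<le> v" "v \<le> 21" "e * of_int (y - v) < 1"
  shows "centred (e - 2) (y - v, y)"
  using assms
proof (induction "nat \<lceil>1 / e - of_int y\<rceil>" arbitrary: y rule: less_induct)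
  case less
  show ?case
  proof (cases "e * of_int y < 1")
    case True
    have "nat \<lceil>1 / e - of_int (y + v)\<rceil> < nat \<lceil>1 / e - of_int y\<rceil>"
    proof -
      have "of_int y < 1 / e" using True e_pos by (simp add: field_simps)
      then have "0 < \<lceil>1 / e - of_int y\<rceil>" by (subst zero_less_ceiling) simp
      moreover have "\<lceil>1 / e - of_int (y + v)\<rceil> = \<lceil>1 / e - of_int y\<rceil> - v"
        by (simp add: algebra_simps flip: ceiling_diff_of_int)
      ultimately show ?thesis using less.prems by simp
    qed
    then have "centred (e - 2) (y + v - v, y + v)"
      using less.prems True by (intro less.hyps) auto
    then show ?thesis using True less.prems by - (rule centred_next, simp add: floor_zero algebra_simps)
  next
    case False
    define u where "u = nat (v - 1)"
    have u: "v = int u + 1" "u \<le> 20" using less.prems by (auto simp: u_def)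
    \<comment> \<open>From the last term below \<open>1/e\<close> the climb is at most 21 + 20 * 21
      / 2 = 231, which is less than \<open>1/e\<close>, so the peak stays below
      \<open>2/e\<close>.\<close>
    have "real u * (real u + 1) \<le> 20 * 21" using u(2) by (intro mult_mono) auto
    then have "e * (of_int v + real u * (real u + 1) / 2) \<le> e * 231"
      using e_pos u by (intro mult_left_mono) auto
    also have "\<dots> < 1" using e_small e_pos by linarith
    finally have "e * of_int (y - v) + e * (of_int v + real u * (real u + 1) / 2) < 2"
      using less.prems(4) by linarith
    then have "centred (e - 2) (y - int u - 1, y)"
      using False by (intro centred_top) (auto simp: algebra_simps)
    then show ?thesis using u by (simp add: algebra_simps)
  qed
qed

lemma centred_nonneg:
  assumes "0 \<le> y" "0 \<le> v" "v \<le> 21" "y \<le> 100"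
  shows "centred (e - 2) (y - v, y)"
proof -
  have "e * of_int y \<le> e * 100" using assms e_pos by (intro mult_left_mono) auto
  then have y1: "e * of_int y < 1" using e_small e_pos by linarith
  show ?thesis
  proof (cases "v = 0")
    case True
    then show ?thesis using assms y1 by (intro centred_now) (simp add: floor_zero)
  next
    case False
    have "e * of_int (y - v) \<le> e * of_int y" using assms e_pos by (intro mult_left_mono) auto
    then show ?thesis using False assms y1 by (intro centred_up) auto
  qed
qed

text \<open>Below 0 the slope grows by one per step. The invariant \<open>v \<le> 21 + y\<close>
  survives because \<open>y\<close> gains \<open>v + 1\<close> while \<open>v\<close> gains 1, and
  it keeps the slope at most 21 when the orbit reaches nonnegative terms.\<close>

lemma centred_rising:
  assumes "y < 0" "-21 \<le> y" "0 \<le> v" "v \<le> 21 + y"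
  shows "centred (e - 2) (y - v, y)"
  using assms
proof (induction "nat (- y)" arbitrary: y v rule: less_induct)
  case less
  have "centred (e - 2) (y + v + 1 - (v + 1), y + v + 1)"
  proof (cases "y + v + 1 < 0")
    case True
    then show ?thesis using less.prems by (intro less.hyps) auto
  next
    case False
    then show ?thesis using less.prems by (intro centred_nonneg) auto
  qed
  then show ?case
    using less.prems by - (rule centred_next, simp add: floor_minus_one algebra_simps)
qed

text \<open>Mirror image of \<open>centred_top\<close>: the slope rises from \<open>-(k + 1)\<close>
  to 0 while the orbit sinks by a further \<open>k (k + 1) / 2\<close>. The second hypothesis keeps
  it from passing -240, down to which the floor is -1.\<close>

lemma centred_sinking:
  assumes "y < 0" "int k * (int k + 1) \<le> 2 * (y + 240)"
  shows "centred (e - 2) (y + int k + 1, y)"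
  using assms
proof (induction k arbitrary: y)
  case 0
  then show ?case by (intro centred_now) (simp add: floor_minus_one)
next
  case (Suc k)
  have "0 \<le> 2 * (y + 240)" by (rule order_trans[OF _ Suc.prems(2)]) simp
  then have y: "-240 \<le> y" by simp
  have "centred (e - 2) (y - int (Suc k) + int k + 1, y - int (Suc k))"
    using Suc.prems by (intro Suc.IH) (auto simp: algebra_simps)
  then show ?case
    using Suc.prems y by - (rule centred_next, simp add: floor_minus_one algebra_simps)
qed

text \<open>The orbit falls in equal steps until the first negative term, which is at least -20.
  From there it sinks by at most 19 * 20 / 2 = 190 and so stays above -240.\<close>

lemma centred_falling:
  assumes "y \<le> 100" "-20 \<le> y" "1 \<le> k" "k \<le> 20"
  shows "centred (e - 2) (y + k, y)"
  using assms
proof (induction "nat (y + 20)" arbitrary: y rule: less_induct)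
  case less
  show ?case
  proof (cases "y < 0")
    case True
    define j where "j = nat (k - 1)"
    have j: "k = int j + 1" "j \<le> 19" using less.prems by (auto simp: j_def)
    have "int j * (int j + 1) \<le> 19 * 20" using j(2) by (intro mult_mono) auto
    then have "centred (e - 2) (y + int j + 1, y)"
      using True less.prems by (intro centred_sinking) auto
    then show ?thesis using j by (simp add: algebra_simps)
  next
    case False
    have "e * of_int y \<le> e * 100" using less.prems e_pos by (intro mult_left_mono) auto
    then have y1: "e * of_int y < 1" using e_small e_pos by linarith
    have "centred (e - 2) (y - k + k, y - k)"
      using less.prems False by (intro less.hyps) auto
    then show ?thesis using False y1 by - (rule centred_next, simp add: floor_zero algebra_simps)
  qed
qed

lemma centred_box:
  assumes "\<bar>x\<bar> \<le> 10" "\<bar>y\<bar> \<le> 10"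
  shows "centred (e - 2) (x, y)"
proof -
  consider "y < x" | "x \<le> y" "y < 0" | "x \<le> y" "0 \<le> y" by linarith
  then show ?thesis
  proof cases
    case 1
    then show ?thesis using centred_falling[of y "x - y"] assms by simp
  next
    case 2
    then show ?thesis using centred_rising[of y "y - x"] assms by simp
  next
    case 3
    then show ?thesis using centred_nonneg[of y "y - x"] assms by simp
  qed
qed

lemma periodic_box_near:
  assumes "\<bar>x\<bar> \<le> 10" "\<bar>y\<bar> \<le> 10"
  shows "periodic_state (e - 2) (x, y)"
  using assms by (intro periodic_of_centred) (simp_all add: centred_box)

end

subsection \<open>A checker for whole intervals of \<open>\<lambda>\<close>\<close>

datatype sint = Zer | Pos num | Neg num

fun sval :: "sint \<Rightarrow> int" where
  "sval Zer = 0"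
| "sval (Pos n) = numeral n"
| "sval (Neg n) = - numeral n"

fun sdup :: "sint \<Rightarrow> sint" where
  "sdup Zer = Zer"
| "sdup (Pos n) = Pos (num.Bit0 n)"
| "sdup (Neg n) = Neg (num.Bit0 n)"

fun sdup_inc :: "sint \<Rightarrow> sint" where
  "sdup_inc Zer = Pos num.One"
| "sdup_inc (Pos n) = Pos (num.Bit1 n)"
| "sdup_inc (Neg n) = Neg (Num.BitM n)"

fun sdup_dec :: "sint \<Rightarrow> sint" where
  "sdup_dec Zer = Neg num.One"
| "sdup_dec (Pos n) = Pos (Num.BitM n)"
| "sdup_dec (Neg n) = Neg (num.Bit1 n)"

fun ndiff :: "num \<Rightarrow> num \<Rightarrow> sint" where
  "ndiff num.One num.One = Zer"
| "ndiff (num.Bit0 m) num.One = Pos (Num.BitM m)"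
| "ndiff (num.Bit1 m) num.One = Pos (num.Bit0 m)"
| "ndiff num.One (num.Bit0 n) = Neg (Num.BitM n)"
| "ndiff num.One (num.Bit1 n) = Neg (num.Bit0 n)"
| "ndiff (num.Bit0 m) (num.Bit0 n) = sdup (ndiff m n)"
| "ndiff (num.Bit1 m) (num.Bit1 n) = sdup (ndiff m n)"
| "ndiff (num.Bit1 m) (num.Bit0 n) = sdup_inc (ndiff m n)"
| "ndiff (num.Bit0 m) (num.Bit1 n) = sdup_dec (ndiff m n)"

text \<open>The negated sum is the operation of the recurrence: applied to \<open>a(n)\<close> and
  the floor of \<open>\<lambda> a(n+1)\<close> it yields \<open>a(n+2)\<close>.\<close>

fun nsum :: "sint \<Rightarrow> sint \<Rightarrow> sint" where
  "nsum Zer Zer = Zer"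
| "nsum Zer (Pos n) = Neg n"
| "nsum Zer (Neg n) = Pos n"
| "nsum (Pos m) Zer = Neg m"
| "nsum (Neg m) Zer = Pos m"
| "nsum (Pos m) (Pos n) = Neg (m + n)"
| "nsum (Pos m) (Neg n) = ndiff n m"
| "nsum (Neg m) (Pos n) = ndiff m n"
| "nsum (Neg m) (Neg n) = Pos (m + n)"

fun sneg :: "sint \<Rightarrow> sint" where
  "sneg Zer = Zer"
| "sneg (Pos n) = Neg n"
| "sneg (Neg n) = Pos n"

fun sless :: "sint \<Rightarrow> sint \<Rightarrow> bool" where
  "sless Zer Zer = False"
| "sless Zer (Pos n) = True"
| "sless Zer (Neg n) = False"
| "sless (Pos m) Zer = False"
| "sless (Neg m) Zer = True"
| "sless (Pos m) (Pos n) = (m < n)"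
| "sless (Pos m) (Neg n) = False"
| "sless (Neg m) (Pos n) = True"
| "sless (Neg m) (Neg n) = (n < m)"

lemma sval_sdup: "sval (sdup x) = 2 * sval x"
  by (cases x) simp_all

lemma sval_sdup_inc: "sval (sdup_inc x) = 2 * sval x + 1"
  by (cases x) simp_all

lemma sval_sdup_dec: "sval (sdup_dec x) = 2 * sval x - 1"
  by (cases x) simp_all

lemma sval_ndiff: "sval (ndiff m n) = numeral m - numeral n"
  by (induction m n rule: ndiff.induct)
    (simp_all add: sval_sdup sval_sdup_inc sval_sdup_dec Num.dbl_def Num.dbl_inc_def Num.dbl_dec_def)

lemma sval_nsum: "sval (nsum x y) = - sval x - sval y"
  by (cases x; cases y) (simp_all add: sval_ndiff)

lemma sval_sneg: "sval (sneg x) = - sval x"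
  by (cases x) simp_all

lemma sless_iff: "sless x y \<longleftrightarrow> sval x < sval y"
  by (cases x; cases y) simp_all

fun le_ten :: "num \<Rightarrow> bool" where
  "le_ten num.One = True"
| "le_ten (num.Bit0 num.One) = True"
| "le_ten (num.Bit1 num.One) = True"
| "le_ten (num.Bit0 (num.Bit0 num.One)) = True"
| "le_ten (num.Bit1 (num.Bit0 num.One)) = True"
| "le_ten (num.Bit0 (num.Bit1 num.One)) = True"
| "le_ten (num.Bit1 (num.Bit1 num.One)) = True"
| "le_ten (num.Bit0 (num.Bit0 (num.Bit0 num.One))) = True"
| "le_ten (num.Bit1 (num.Bit0 (num.Bit0 num.One))) = True"
| "le_ten (num.Bit0 (num.Bit1 (num.Bit0 num.One))) = True"
| "le_ten _ = False"

lemma le_ten_imp: "le_ten n \<Longrightarrow> n \<le> num.Bit0 (num.Bit1 (num.Bit0 num.One))"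
  by (induction n rule: le_ten.induct) simp_all

fun in_box :: "sint \<Rightarrow> bool" where
  "in_box Zer = True"
| "in_box (Pos n) = le_ten n"
| "in_box (Neg n) = le_ten n"

lemma in_box_imp: "in_box x \<Longrightarrow> \<bar>sval x\<bar> \<le> 10"
  by (cases x) (simp_all add: le_ten_imp)

text \<open>A row stores \<open>\<lfloor>\<lambda> y\<rfloor>\<close> for one fixed \<open>y\<close> as a step function of the position of \<open>\<lambda>\<close>.\<close>

datatype row = Lf sint | Br num sint row | Unknown

fun row_val :: "row \<Rightarrow> int \<Rightarrow> int" where
  "row_val (Lf f) p = sval f"
| "row_val (Br k f r) p = (if numeral k \<le> p then row_val r p else sval f)"
| "row_val Unknown p = 0"

datatype env = Env num num sint sint bool

datatype verdict = Stop | Centre | Continue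

fun lex_less :: "sint \<Rightarrow> sint \<Rightarrow> sint \<Rightarrow> sint \<Rightarrow> bool" where
  "lex_less s t u v = (sless s u \<or> s = u \<and> sless t v)"

text \<open>The start \<open>(u, v)\<close> has \<open>u \<le> v\<close>; the flag records whether
  \<open>y < z\<close>, hence which entry of \<open>(y, z)\<close> is compared with
  \<open>u\<close>. An exact return to the start counts as well.\<close>

fun earlier_aux :: "sint \<Rightarrow> sint \<Rightarrow> sint \<Rightarrow> sint \<Rightarrow> bool \<Rightarrow> bool" where
  "earlier_aux u v y z True = (lex_less y z u v \<or> y = u \<and> z = v)"
| "earlier_aux u v y z False = (lex_less z y u v \<or> y = u \<and> z = v)"

text \<open>The verdict is a cascade of functions, each matching on one Boolean, so that the
  comparison with the start is only evaluated for pairs inside the box.\<close>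

fun verdict3 :: "bool \<Rightarrow> bool \<Rightarrow> verdict" where
  "verdict3 True b = Centre"
| "verdict3 False True = Centre"
| "verdict3 False False = Continue"

fun verdict2 :: "sint \<Rightarrow> sint \<Rightarrow> sint \<Rightarrow> bool \<Rightarrow> verdict" where
  "verdict2 x y z True = Stop"
| "verdict2 x y z False = verdict3 (x = z) (y = z)"

fun verdict1 :: "env \<Rightarrow> sint \<Rightarrow> sint \<Rightarrow> sint \<Rightarrow> bool \<Rightarrow> verdict" where
  "verdict1 (Env a b u v q) x y z True = verdict2 x y z (earlier_aux u v y z (sless y z))"
| "verdict1 e x y z False = verdict3 (x = z) (y = z)"

fun verdict0 :: "env \<Rightarrow> sint \<Rightarrow> sint \<Rightarrow> sint \<Rightarrow> bool \<Rightarrow> verdict" where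
  "verdict0 e x y z True = verdict1 e x y z (in_box z)"
| "verdict0 e x y z False = verdict3 (x = z) (y = z)"

text \<open>The order is lexicographic on the sorted pair, so a pair and its swap rank alike;
  equality is included because a return to the start also ends a walk.\<close>

definition earlier :: "int \<times> int \<Rightarrow> int \<times> int \<Rightarrow> bool" where
  "earlier s t \<longleftrightarrow> s = t \<or> \<bar>fst s\<bar> \<le> 10 \<and> \<bar>snd s\<bar> \<le> 10 \<and>
     (min (fst s) (snd s) < min (fst t) (snd t) \<or>
      min (fst s) (snd s) = min (fst t) (snd t) \<and> max (fst s) (snd s) < max (fst t) (snd t))"

lemma verdict3_eq: "verdict3 p q \<noteq> Stop" "verdict3 p q = Centre \<longleftrightarrow> p \<or> q"
  by (cases p; cases q; simp)+

lemma verdict0_Stop: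
  assumes "verdict0 (Env a b u v q) x y z (in_box y) = Stop" "sval u \<le> sval v"
  shows "earlier (sval y, sval z) (sval u, sval v)"
proof -
  have y: "in_box y"
    using assms(1) by (cases "in_box y") (simp_all add: verdict3_eq)
  have z: "in_box z"
    using assms(1) y by (cases "in_box z") (simp_all add: verdict3_eq)
  have e: "earlier_aux u v y z (sless y z)"
    using assms(1) y z
    by (cases "earlier_aux u v y z (sless y z)") (simp_all add: verdict3_eq del: earlier_aux.simps)
  show ?thesis
  proof (cases "sless y z")
    case True
    then have "sval y < sval u \<or> sval y = sval u \<and> sval z < sval v \<or> sval y = sval u \<and> sval z = sval v"
      using e by (auto simp: sless_iff)
    then show ?thesis
      using True in_box_imp[OF y] in_box_imp[OF z] assms(2)
      unfolding earlier_def sless_iff fst_conv snd_conv by (auto simp: min_def max_def)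
  next
    case False
    then have "sval z < sval u \<or> sval z = sval u \<and> sval y < sval v \<or> sval y = sval u \<and> sval z = sval v"
      using e by (auto simp: sless_iff)
    then show ?thesis
      using False in_box_imp[OF y] in_box_imp[OF z] assms(2)
      unfolding earlier_def sless_iff fst_conv snd_conv by (auto simp: min_def max_def)
  qed
qed

lemma verdict0_Centre:
  assumes "verdict0 (Env a b u v q) x y z (in_box y) = Centre"
  shows "x = z \<or> y = z"
proof (cases "in_box y \<and> in_box z")
  case True
  then show ?thesis
    using assms by (cases "earlier_aux u v y z (sless y z)") (simp_all add: verdict3_eq del: earlier_aux.simps)
next
  case False
  then show ?thesis
    using assms by (cases "in_box y"; cases "in_box z") (simp_all add: verdict3_eq)
qed

section \<open>Binary long division\<close>

fun sinc :: "sint \<Rightarrow> sint" where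
  "sinc x = sneg (nsum x (Pos num.One))"

fun ssub :: "sint \<Rightarrow> sint \<Rightarrow> sint" where
  "ssub x y = nsum (sneg x) y"

fun sint_num :: "sint \<Rightarrow> num" where
  "sint_num (Pos n) = n"
| "sint_num Zer = num.One"
| "sint_num (Neg n) = num.One"

fun sint_nat :: "sint \<Rightarrow> nat" where
  "sint_nat (Pos n) = nat_of_num n"
| "sint_nat Zer = 0"
| "sint_nat (Neg n) = 0"

fun sub_num :: "sint \<Rightarrow> num \<Rightarrow> sint" where
  "sub_num Zer y = Neg y"
| "sub_num (Pos r) y = ndiff r y"
| "sub_num (Neg r) y = Neg (r + y)"

text \<open>One digit of the quotient: the third argument is \<open>r\<close> minus the divisor, and
  its sign decides the new bit.\<close>

fun div_step :: "sint \<Rightarrow> sint \<Rightarrow> sint \<Rightarrow> sint \<times> sint" where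
  "div_step q r (Neg d) = (sdup q, r)"
| "div_step q r Zer = (sdup_inc q, Zer)"
| "div_step q r (Pos d) = (sdup_inc q, Pos d)"

fun div_even :: "sint \<times> sint \<Rightarrow> num \<Rightarrow> sint \<times> sint" where
  "div_even (q, r) y = div_step q (sdup r) (sub_num (sdup r) y)"

fun div_odd :: "sint \<times> sint \<Rightarrow> num \<Rightarrow> sint \<times> sint" where
  "div_odd (q, r) y = div_step q (sdup_inc r) (sub_num (sdup_inc r) y)"

fun div_num :: "num \<Rightarrow> num \<Rightarrow> sint \<times> sint" where
  "div_num num.One y = div_odd (Zer, Zer) y"
| "div_num (num.Bit0 n) y = div_even (div_num n y) y"
| "div_num (num.Bit1 n) y = div_odd (div_num n y) y"

fun quo :: "num \<Rightarrow> num \<Rightarrow> sint" where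
  "quo n y = fst (div_num n y)"

lemma sval_sub_num: "sval (sub_num x y) = sval x - numeral y"
  by (cases x) (simp_all add: sval_ndiff)

lemma div_step_spec:
  fixes Y :: int
  assumes "sval d = sval r - Y" "0 \<le> sval r" "sval r < 2 * Y" "div_step q r d = (q', r')"
  shows "sval q' * Y + sval r' = 2 * (sval q * Y) + sval r \<and> 0 \<le> sval r' \<and> sval r' < Y"
proof -
  have "sval d < 0 \<and> q' = sdup q \<and> r' = r \<or> 0 \<le> sval d \<and> q' = sdup_inc q \<and> sval r' = sval d"
    using assms(4) by (cases d) auto
  then show ?thesis
    using assms(1-3) by (auto simp: sval_sdup sval_sdup_inc distrib_right)
qed

lemma div_num_spec:
  "div_num n y = (q, r) \<Longrightarrow>
    sval q * numeral y + sval r = numeral n \<and> 0 \<le> sval r \<and> sval r < numeral y"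
proof (induction n arbitrary: q r)
  case One
  then show ?case
    using div_step_spec[OF sval_sub_num, of "sdup_inc Zer" y Zer q r] by (simp add: sval_sdup_inc)
next
  case (Bit0 n)
  obtain q0 r0 where e: "div_num n y = (q0, r0)" by fastforce
  have n: "numeral (num.Bit0 n) = 2 * (numeral n :: int)" by simp
  have d: "div_step q0 (sdup r0) (sub_num (sdup r0) y) = (q, r)"
    using Bit0.prems e by simp
  show ?case
    using Bit0.IH[OF e] div_step_spec[OF sval_sub_num _ _ d] unfolding sval_sdup n by linarith
next
  case (Bit1 n)
  obtain q0 r0 where e: "div_num n y = (q0, r0)" by fastforce
  have n: "numeral (num.Bit1 n) = 2 * (numeral n :: int) + 1" by simp
  have d: "div_step q0 (sdup_inc r0) (sub_num (sdup_inc r0) y) = (q, r)"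
    using Bit1.prems e by simp
  show ?case
    using Bit1.IH[OF e] div_step_spec[OF sval_sub_num _ _ d] unfolding sval_sdup_inc n by linarith
qed

lemma sval_quo: "sval (quo n y) = numeral n div numeral y"
proof -
  obtain q r where e: "div_num n y = (q, r)" by fastforce
  have "(numeral n :: int) div numeral y = sval q"
    using div_num_spec[OF e] by (intro int_div_pos_eq[of _ _ _ "sval r"]) (simp_all add: mult.commute)
  then show ?thesis using e by simp
qed

lemma sval_ssub: "sval (ssub x y) = sval x - sval y"
  by (simp add: sval_nsum sval_sneg)

lemma sval_sinc: "sval (sinc x) = sval x + 1"
  by (simp add: sval_nsum sval_sneg)

lemma numeral_sint_num: "0 < sval x \<Longrightarrow> numeral (sint_num x) = sval x"
  by (cases x) auto

lemma sint_nat_eq: "sint_nat x = nat (sval x)"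
  by (cases x) (simp_all add: nat_of_num_numeral)

text \<open>\<open>Cell l r D K N b\<close> describes the values \<open>\<lambda> + 2\<close> between \<open>l / D\<close> and \<open>r / D\<close>. The thresholds at
  which some \<open>\<lfloor>(\<lambda> + 2) w\<rfloor>\<close> with \<open>w \<le> N\<close> jumps are fractions \<open>j / w\<close>; they are encoded, relative to
  \<open>b = \<lfloor>K l / D\<rfloor>\<close>, by \<open>\<lfloor>K j / w\<rfloor> - b\<close>, which is strictly monotone if \<open>N\<^sup>2 \<le> K\<close>. An even cut \<open>Bit0\<close>
  separates \<open>\<lambda> + 2 < j / w\<close> from \<open>\<lambda> + 2 \<ge> j / w\<close>, an odd cut \<open>Bit1\<close> separates \<open>\<le>\<close> from \<open>>\<close>.\<close>

datatype cell = Cell num num num num num num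

fun rel_code :: "num \<Rightarrow> num \<Rightarrow> num \<Rightarrow> num \<Rightarrow> num" where
  "rel_code K b w j = sint_num (ssub (quo (K * j) w) (Pos b))"

fun row_pos :: "num \<Rightarrow> num \<Rightarrow> num \<Rightarrow> sint \<Rightarrow> num \<Rightarrow> nat \<Rightarrow> row" where
  "row_pos K b w v j 0 = Lf v"
| "row_pos K b w v j (Suc n) =
     Br (num.Bit0 (rel_code K b w j)) v (row_pos K b w (sinc v) (Num.inc j) n)"

text \<open>For \<open>-w\<close> the floor is minus the ceiling of \<open>\<lambda> w\<close>.
  Since \<open>v\<close> is the floor of \<open>\<lambda> w\<close> in the gap below
  \<open>j / w\<close>, the value there is \<open>-v - 1\<close>; the cut is odd because the ceiling
  jumps only beyond the fraction.\<close>

fun row_neg :: "num \<Rightarrow> num \<Rightarrow> num \<Rightarrow> sint \<Rightarrow> num \<Rightarrow> nat \<Rightarrow> row" where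
  "row_neg K b w v j 0 = Lf (nsum v (Pos num.One))"
| "row_neg K b w v j (Suc n) =
     Br (num.Bit1 (rel_code K b w j)) (nsum v (Pos num.One)) (row_neg K b w (sinc v) (Num.inc j) n)"

text \<open>The row lists the fractions \<open>j / w\<close> in \<open>(pl / D, pr / D]\<close>,
  starting one above the floor of \<open>pl * w / D\<close>. Subtracting \<open>2 * w\<close> passes
  from \<open>\<lambda> + 2\<close> to \<open>\<lambda>\<close>.\<close>

fun look :: "cell \<Rightarrow> sint \<Rightarrow> row" where
  "look (Cell pl pr D K N b) Zer = Lf Zer"
| "look (Cell pl pr D K N b) (Pos w) = (if w \<le> N then
     row_pos K b w (ssub (quo (pl * w) D) (Pos (num.Bit0 w))) (sint_num (sinc (quo (pl * w) D)))
       (sint_nat (ssub (quo (pr * w) D) (quo (pl * w) D))) else Unknown)"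
| "look (Cell pl pr D K N b) (Neg w) = (if w \<le> N then
     row_neg K b w (ssub (quo (pl * w) D) (Pos (num.Bit0 w))) (sint_num (sinc (quo (pl * w) D)))
       (sint_nat (ssub (quo (pr * w) D) (quo (pl * w) D))) else Unknown)"

text \<open>\<open>walk c (Env a b u v q) x y\<close> follows the orbit from \<open>(x, y)\<close> simultaneously for all \<open>\<lambda>\<close> at
  positions in \<open>[a, b)\<close>, splitting this interval at ambiguous rows. It started at \<open>(u, v)\<close> if \<open>q\<close> is
  false, and at \<open>(v, u)\<close> (the backward orbit) if \<open>q\<close> is true.\<close>

inductive walk :: "cell \<Rightarrow> env \<Rightarrow> sint \<Rightarrow> sint \<Rightarrow> bool"
  and walk_row :: "cell \<Rightarrow> env \<Rightarrow> sint \<Rightarrow> sint \<Rightarrow> row \<Rightarrow> bool" for c where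
  walkI: "walk_row c e x y (look c y) \<Longrightarrow> walk c e x y"
| stop: "verdict0 e x y (nsum x f) (in_box y) = Stop \<Longrightarrow> walk_row c e x y (Lf f)"
| centre: "verdict0 (Env a b u v q) x y (nsum x f) (in_box y) = Centre \<Longrightarrow>
    q \<or> walk c (Env a b u v True) v u \<Longrightarrow> walk_row c (Env a b u v q) x y (Lf f)"
| continue: "verdict0 e x y (nsum x f) (in_box y) = Continue \<Longrightarrow>
    walk c e y (nsum x f) \<Longrightarrow> walk_row c e x y (Lf f)"
| right: "k \<le> a \<Longrightarrow> walk_row c (Env a b u v q) x y r \<Longrightarrow>
    walk_row c (Env a b u v q) x y (Br k f r)"
| left: "\<not> k \<le> a \<Longrightarrow> b \<le> k \<Longrightarrow> walk_row c (Env a b u v q) x y (Lf f) \<Longrightarrow>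
    walk_row c (Env a b u v q) x y (Br k f r)"
| both: "\<not> k \<le> a \<Longrightarrow> \<not> b \<le> k \<Longrightarrow> walk_row c (Env a k u v q) x y (Lf f) \<Longrightarrow>
    walk_row c (Env k b u v q) x y r \<Longrightarrow> walk_row c (Env a b u v q) x y (Br k f r)"

definition follow :: "cell \<Rightarrow> env \<Rightarrow> sint \<Rightarrow> sint \<Rightarrow> sint \<Rightarrow> verdict \<Rightarrow> bool" where
  "follow c e x y z m = (case m of Stop \<Rightarrow> True
    | Centre \<Rightarrow> (case e of Env a b u v q \<Rightarrow> q \<or> walk c (Env a b u v True) v u)
    | Continue \<Rightarrow> walk c e y z)"

definition visit :: "cell \<Rightarrow> env \<Rightarrow> sint \<Rightarrow> sint \<Rightarrow> sint \<Rightarrow> bool" where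
  "visit c e x y z = follow c e x y z (verdict0 e x y z (in_box y))"

definition choose_left where
  "choose_left c a b u v q x y k f r t = (if t then walk_row c (Env a b u v q) x y (Lf f)
     else walk_row c (Env a k u v q) x y (Lf f) \<and> walk_row c (Env k b u v q) x y r)"

definition choose_right where
  "choose_right c a b u v q x y k f r t = (if t then walk_row c (Env a b u v q) x y r
     else choose_left c a b u v q x y k f r (b \<le> k))"

text \<open>An orbit search has no evident termination measure, so it is an inductive predicate.
  These equations run it as a program; each test is an argument that is evaluated before a branch is
  unfolded.\<close>

lemma walk_eqs:
  "walk c e x y = walk_row c e x y (look c y)"
  "walk_row c e x y (Lf f) = visit c e x y (nsum x f)"
  "walk_row c (Env a b u v q) x y (Br k f r) = choose_right c a b u v q x y k f r (k \<le> a)"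
  "visit c e x y z = follow c e x y z (verdict0 e x y z (in_box y))"
  "follow c e x y z Stop = True"
  "follow c (Env a b u v True) x y z Centre = True"
  "follow c (Env a b u v False) x y z Centre = walk c (Env a b u v True) v u"
  "follow c e x y z Continue = walk c e y z"
  "choose_right c a b u v q x y k f r True = walk_row c (Env a b u v q) x y r"
  "choose_right c a b u v q x y k f r False = choose_left c a b u v q x y k f r (b \<le> k)"
  "choose_left c a b u v q x y k f r True = walk_row c (Env a b u v q) x y (Lf f)"
  "choose_left c a b u v q x y k f r False =
    (walk_row c (Env a k u v q) x y (Lf f) \<and> walk_row c (Env k b u v q) x y r)"
proof -
  show "walk c e x y = walk_row c e x y (look c y)"
    by (subst walk.simps) simp
  show "walk_row c e x y (Lf f) = visit c e x y (nsum x f)"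
    by (cases e, subst walk_row.simps)
      (cases "verdict0 e x y (nsum x f) (in_box y)"; auto simp: visit_def follow_def)
  show "walk_row c (Env a b u v q) x y (Br k f r) = choose_right c a b u v q x y k f r (k \<le> a)"
    by (subst walk_row.simps) (auto simp: choose_left_def choose_right_def)
qed (simp_all add: visit_def follow_def choose_left_def choose_right_def)

text \<open>What a successful walk proves. If \<open>q\<close> holds, one centre is enough: either
  the walk is already the backward half, or \<open>u = v\<close> and both halves agree.\<close>

definition sat :: "real \<Rightarrow> bool \<Rightarrow> int \<times> int \<Rightarrow> int \<times> int \<Rightarrow> bool" where
  "sat l q s t \<longleftrightarrow> (\<exists>n>0. earlier ((step l ^^ n) t) s) \<or>
     centred l t \<and> (q \<or> (\<exists>n>0. earlier ((step l ^^ n) (prod.swap s)) s) \<or> centred l (prod.swap s))"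

lemma sat_step: "sat l q s (step l t) \<Longrightarrow> sat l q s t"
proof -
  have "(\<exists>n>0. earlier ((step l ^^ n) (step l t)) s) \<Longrightarrow> (\<exists>n>0. earlier ((step l ^^ n) t) s)"
    by (metis funpow_Suc_right o_apply zero_less_Suc)
  then show "sat l q s (step l t) \<Longrightarrow> sat l q s t"
    unfolding sat_def using centred_step by blast
qed

lemma walk_sound:
  assumes tab: "\<And>y. look c y \<noteq> Unknown \<Longrightarrow> row_val (look c y) p = \<lfloor>l * of_int (sval y)\<rfloor>"
  shows "walk c e x y \<Longrightarrow>
      (\<And>a b u v q. e = Env a b u v q \<Longrightarrow> numeral a \<le> p \<Longrightarrow> p < numeral b \<Longrightarrow>
        sval u \<le> sval v \<Longrightarrow> sat l q (sval u, sval v) (sval x, sval y))"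
    and "walk_row c e x y r \<Longrightarrow>
      (\<And>a b u v q. e = Env a b u v q \<Longrightarrow> numeral a \<le> p \<Longrightarrow> p < numeral b \<Longrightarrow>
        sval u \<le> sval v \<Longrightarrow> row_val r p = \<lfloor>l * of_int (sval y)\<rfloor> \<Longrightarrow>
      sat l q (sval u, sval v) (sval x, sval y))"
proof (induction rule: walk_walk_row.inducts)
  case (walkI e x y)
  \<comment> \<open>No rule of \<open>walk_row\<close> concludes about \<open>Unknown\<close>, so a
    derivation never leaves the table.\<close>
  have "look c y \<noteq> Unknown"
    using walkI(1) by (auto elim: walk_row.cases)
  then show ?case using walkI tab by blast
next
  case (stop e x y f)
  have "step l (sval x, sval y) = (sval y, sval (nsum x f))"
    using stop.prems by (simp add: step_def sval_nsum)
  then have "earlier ((step l ^^ 1) (sval x, sval y)) (sval u, sval v)"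
    using verdict0_Stop stop by simp
  then show ?case unfolding sat_def by blast
next
  case (centre a' b' u' v' q' x y f)
  have s: "step l (sval x, sval y) = (sval y, sval (nsum x f))"
    using centre.prems by (simp add: step_def sval_nsum)
  have "x = nsum x f \<or> y = nsum x f"
    using verdict0_Centre centre.hyps(1) by blast
  then have "sval (nsum x f) = sval x \<or> sval (nsum x f) = sval y"
    by metis
  then have "centred l (sval x, sval y)"
    unfolding centred_def using s by (intro exI[of _ 0]) auto
  moreover have "q' \<or> sat l True (sval u, sval v) (sval v, sval u)"
    using centre by auto
  ultimately show ?case using centre.prems unfolding sat_def by auto
next
  case (continue e x y f)
  have "step l (sval x, sval y) = (sval y, sval (nsum x f))"
    using continue.prems by (simp add: step_def sval_nsum)
  then show ?case using continue by (metis sat_step)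
next
  case (right k a' b' u' v' q' x y r f)
  have "numeral k \<le> (numeral a' :: int)" using right by simp
  then have "numeral k \<le> p" by (rule order_trans) (use right.prems in simp)
  then have "row_val r p = \<lfloor>l * of_int (sval y)\<rfloor>" using right.prems by simp
  then show ?case using right.IH right.prems by blast
next
  case (left k a' b' u' v' q' x y f r)
  have "numeral b' \<le> (numeral k :: int)" using left by simp
  moreover have "p < numeral b'" using left.prems by simp
  ultimately have "\<not> numeral k \<le> p" by linarith
  then have "row_val (Lf f) p = \<lfloor>l * of_int (sval y)\<rfloor>" using left.prems by simp
  then show ?case using left.IH left.prems by blast
next
  case (both k a' b' u' v' q' x y f r)
  then show ?case by (cases "numeral k \<le> p") auto
qed

subsection \<open>Positions and the correctness of rows\<close>

lemma code_mono:
  fixes K j w j' w' :: int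
  assumes "0 < K" "of_int j / of_int w \<le> (of_int j' / of_int w' :: real)"
  shows "K * j div w \<le> K * j' div w'"
proof -
  have "of_int K * (of_int j / of_int w) \<le> of_int K * (of_int j' / of_int w' :: real)"
    using assms by (intro mult_left_mono) auto
  then have "\<lfloor>of_int (K * j) / of_int w :: real\<rfloor> \<le> \<lfloor>of_int (K * j') / of_int w' :: real\<rfloor>"
    by (intro floor_mono) simp
  then show ?thesis by (simp only: floor_divide_of_int_eq)
qed

text \<open>Distinct fractions with denominators at most \<open>N\<close> differ by at least \<open>1 / N\<^sup>2\<close>.\<close>

lemma code_strict_mono:
  fixes K N j w j' w' :: int
  assumes "N * N \<le> K" "0 < w" "w \<le> N" "0 < w'" "w' \<le> N"
    and less: "of_int j / of_int w < (of_int j' / of_int w' :: real)"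
  shows "K * j div w < K * j' div w'"
proof -
  have "of_int (j * w') < (of_int (j' * w) :: real)"
    using less assms by (simp add: field_simps)
  then have 1: "j * w' + 1 \<le> j' * w" by linarith
  have "w * w' \<le> N * N" using assms by (intro mult_mono) auto
  then have ww: "w * w' \<le> K" using assms by linarith
  have "0 \<le> K" using assms ww by (smt (verit) mult_pos_pos)
  then have "K * (j * w' + 1) \<le> K * (j' * w)" using 1 by (intro mult_left_mono)
  then have "K * j * w' + w * w' \<le> K * j' * w" using ww by (simp add: algebra_simps)
  then have "of_int (K * j * w' + w * w') \<le> (of_int (K * j' * w) :: real)" by (simp only: of_int_le_iff)
  then have "of_int (K * j) / of_int w + 1 \<le> (of_int (K * j') / of_int w' :: real)"
    using assms by (simp add: field_simps)
  then have "\<lfloor>of_int (K * j) / of_int w + 1 :: real\<rfloor> \<le> \<lfloor>of_int (K * j') / of_int w' :: real\<rfloor>"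
    by (rule floor_mono)
  then show ?thesis unfolding one_add_floor[symmetric] floor_divide_of_int_eq by linarith
qed

text \<open>The position of \<open>m\<close> among the fractions \<open>j / w\<close>: the even number \<open>2 \<lfloor>K j / w\<rfloor>\<close> stands for the
  fraction itself, its odd successor for the gap above it.\<close>

definition position :: "int \<Rightarrow> int \<Rightarrow> real \<Rightarrow> int \<Rightarrow> bool" where
  "position K N m p \<longleftrightarrow> (\<forall>j w. 0 \<le> j \<longrightarrow> j \<le> 4 * N \<longrightarrow> 0 < w \<longrightarrow> w \<le> N \<longrightarrow>
     (of_int j / of_int w \<le> m \<longleftrightarrow> 2 * (K * j div w) \<le> p) \<and>
     (of_int j / of_int w < m \<longleftrightarrow> 2 * (K * j div w) + 1 \<le> p))"

text \<open>Take the largest admissible fraction not above \<open>m\<close>: \<open>p\<close> is its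
  doubled code, plus one unless \<open>m\<close> equals it. By \<open>code_strict_mono\<close> all
  other fractions fall on the correct side.\<close>

lemma position_exists:
  assumes K: "N * N \<le> K" and N: "0 < N" and m: "0 \<le> m"
  shows "\<exists>p. position K N m p"
proof -
  let ?P = "{0..4 * N} \<times> {1..N}"
  define g where "g = (\<lambda>s :: int \<times> int. of_int (fst s) / of_int (snd s) :: real)"
  define S where "S = {s \<in> ?P. g s \<le> m}"
  have fin: "finite (g ` S)" unfolding S_def by simp
  have "(0, 1) \<in> S" using N m by (simp add: S_def g_def)
  then have "Max (g ` S) \<in> g ` S" using fin by (intro Max_in) auto
  then obtain s where s: "s \<in> S" "g s = Max (g ` S)" by (metis imageE)
  obtain j w where jw: "s = (j, w)" by fastforce
  have jw': "0 \<le> j" "j \<le> 4 * N" "0 < w" "w \<le> N" "of_int j / of_int w \<le> m"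
    using s(1) by (auto simp: S_def jw g_def)
  have max: "of_int j' / of_int w' \<le> (of_int j / of_int w :: real)"
    if "0 \<le> j'" "j' \<le> 4 * N" "0 < w'" "w' \<le> N" "of_int j' / of_int w' \<le> m" for j' w'
  proof -
    have "(j', w') \<in> S" using that by (simp add: S_def g_def)
    then have "g (j', w') \<le> g s" using fin s(2) by simp
    then show ?thesis by (simp add: g_def jw)
  qed
  have "0 < N * N" using N by simp
  then have K0: "0 < K" using K by linarith
  define p where "p = 2 * (K * j div w) + (if of_int j / of_int w = m then 0 else 1)"
  have "position K N m p"
    unfolding position_def
  proof (intro allI impI)
    fix j' w' :: int
    assume h: "0 \<le> j'" "j' \<le> 4 * N" "0 < w'" "w' \<le> N"
    let ?t = "of_int j' / of_int w' :: real" and ?s = "of_int j / of_int w :: real"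
    have less: "?t < ?s \<Longrightarrow> K * j' div w' < K * j div w"
      using code_strict_mono[OF K h(3,4) jw'(3,4)] .
    have gr: "?s < ?t \<Longrightarrow> K * j div w < K * j' div w'"
      using code_strict_mono[OF K jw'(3,4) h(3,4)] .
    have eq: "?s = ?t \<Longrightarrow> K * j div w = K * j' div w'"
      using code_mono[OF K0, of j w j' w'] code_mono[OF K0, of j' w' j w] by simp
    have t: "?t \<le> m \<longleftrightarrow> ?t \<le> ?s"
      using max[OF h] jw'(5) by linarith
    consider "?t < ?s" | "?t = ?s" | "?s < ?t" by linarith
    then show "(?t \<le> m \<longleftrightarrow> 2 * (K * j' div w') \<le> p) \<and> (?t < m \<longleftrightarrow> 2 * (K * j' div w') + 1 \<le> p)"
    proof cases
      case 1
      then show ?thesis using less jw'(5) by (auto simp: p_def)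
    next
      case 2
      then show ?thesis using eq jw'(5) by (auto simp: p_def)
    next
      case 3
      then have "K * j div w < K * j' div w'" "\<not> ?t \<le> m" using gr t by auto
      then show ?thesis by (auto simp: p_def)
    qed
  qed
  then show ?thesis by blast
qed

lemma numeral_square_le: "n * n \<le> k \<Longrightarrow> numeral n * numeral n \<le> (numeral k :: int)"
  by (simp only: numeral_times_numeral numeral_le_iff)

context
  fixes pl pr D K N b :: num and m :: real and p :: int
  assumes K: "N * N \<le> K" and D: "D \<le> N" and pr: "pr \<le> num.Bit0 (num.Bit0 D)"
    and b: "quo (K * pl) D = Pos b"
    and m_gt: "numeral pl / numeral D < m" and m_le: "m \<le> numeral pr / numeral D"
    and pos: "position (numeral K) (numeral N) m (p + 2 * numeral b)"
begin

lemma numeral_b: "numeral b = (numeral K * numeral pl div numeral D :: int)"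
  using sval_quo[of "K * pl" D] unfolding b by (simp only: sval.simps numeral_mult)

text \<open>\<open>sint_num\<close> is faithful only on positive values. Positivity holds because
  \<open>D \<le> N\<close> makes \<open>pl / D\<close> one of the coded fractions, and it lies
  strictly to the left of \<open>j / w\<close>.\<close>

lemma numeral_rel_code:
  assumes "w \<le> N" "(numeral pl / numeral D :: real) < numeral j / numeral w"
  shows "numeral (rel_code K b w j) = (numeral K * numeral j div numeral w - numeral b :: int)"
proof -
  have v: "sval (ssub (quo (K * j) w) (Pos b)) = numeral K * numeral j div numeral w - numeral b"
    by (simp only: sval_ssub sval_quo numeral_mult sval.simps)
  have "numeral K * numeral pl div numeral D < (numeral K * numeral j div numeral w :: int)"
    using assms D by (intro code_strict_mono[OF numeral_square_le[OF K]]) simp_all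
  then have "0 < sval (ssub (quo (K * j) w) (Pos b))"
    unfolding v numeral_b by simp
  then have "numeral (sint_num (ssub (quo (K * j) w) (Pos b))) = sval (ssub (quo (K * j) w) (Pos b))"
    by (rule numeral_sint_num)
  then show ?thesis unfolding rel_code.simps v .
qed

lemma rel_code_le:
  assumes "w \<le> N" "(numeral pl / numeral D :: real) < numeral j / numeral w"
    "(numeral j :: int) \<le> 4 * numeral N"
  shows "numeral (num.Bit0 (rel_code K b w j)) \<le> p \<longleftrightarrow> numeral j / numeral w \<le> m"
    and "numeral (num.Bit1 (rel_code K b w j)) \<le> p \<longleftrightarrow> numeral j / numeral w < m"
proof -
  have 1: "numeral (num.Bit0 (rel_code K b w j)) = 2 * (numeral K * numeral j div numeral w - numeral b :: int)"
    "numeral (num.Bit1 (rel_code K b w j)) = 2 * (numeral K * numeral j div numeral w - numeral b :: int) + 1"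
    unfolding numeral_Bit0[of "rel_code K b w j"] numeral_Bit1[of "rel_code K b w j"]
      numeral_rel_code[OF assms(1,2)] by (simp_all only: mult_2)
  have aux: "2 * (X - B) \<le> p \<longleftrightarrow> 2 * X \<le> p + 2 * B"
    "2 * (X - B) + 1 \<le> p \<longleftrightarrow> 2 * X + 1 \<le> p + 2 * B" for X B :: int by auto
  have "(of_int (numeral j) / of_int (numeral w) \<le> m \<longleftrightarrow>
      2 * (numeral K * numeral j div numeral w) \<le> p + 2 * numeral b) \<and>
    (of_int (numeral j) / of_int (numeral w) < m \<longleftrightarrow>
      2 * (numeral K * numeral j div numeral w) + 1 \<le> p + 2 * numeral b)"
    using pos assms unfolding position_def by (simp only: zero_le_numeral zero_less_numeral numeral_le_iff)
  then show "numeral (num.Bit0 (rel_code K b w j)) \<le> p \<longleftrightarrow> numeral j / numeral w \<le> m"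
    "numeral (num.Bit1 (rel_code K b w j)) \<le> p \<longleftrightarrow> numeral j / numeral w < m"
    unfolding 1 of_int_numeral aux by blast+
qed

text \<open>The floor is known to lie in a window from \<open>j - 1\<close> to
  \<open>j - 1 + n\<close>. The cut at \<open>j / w\<close> either settles it as
  \<open>j - 1\<close> or moves the lower end of the window up by one.\<close>

lemma row_val_row_pos:
  assumes "w \<le> N" "(numeral pl / numeral D :: real) < numeral j / numeral w"
    and "numeral j + int n \<le> 4 * numeral N + 1"
    and "numeral j - 1 \<le> \<lfloor>m * numeral w\<rfloor>" "\<lfloor>m * numeral w\<rfloor> \<le> numeral j - 1 + int n"
    and "sval v = numeral j - 1 - 2 * numeral w"
  shows "row_val (row_pos K b w v j n) p = \<lfloor>m * numeral w\<rfloor> - 2 * numeral w"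
  using assms
proof (induction n arbitrary: v j)
  case 0
  then show ?case by simp
next
  case (Suc n)
  have jN: "(numeral j :: int) \<le> 4 * numeral N" using Suc.prems(3) by linarith
  have "numeral (num.Bit0 (rel_code K b w j)) \<le> p \<longleftrightarrow> numeral j / numeral w \<le> m"
    by (rule rel_code_le(1)[OF Suc.prems(1,2) jN])
  also have "\<dots> \<longleftrightarrow> of_int (numeral j) \<le> m * numeral w"
    by (simp add: field_simps)
  also have "\<dots> \<longleftrightarrow> numeral j \<le> \<lfloor>m * numeral w\<rfloor>"
    by (rule le_floor_iff[symmetric])
  finally have iff: "numeral (num.Bit0 (rel_code K b w j)) \<le> p \<longleftrightarrow> numeral j \<le> \<lfloor>m * numeral w\<rfloor>" .
  show ?case
  proof (cases "numeral j \<le> \<lfloor>m * numeral w\<rfloor>")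
    case True
    have j1: "numeral (Num.inc j) = (numeral j + 1 :: int)" by (rule numeral_inc)
    have j2: "numeral (Num.inc j) = (numeral j + 1 :: real)" by (rule numeral_inc)
    have "(numeral j :: real) / numeral w \<le> numeral (Num.inc j) / numeral w"
      unfolding j2 by (rule divide_right_mono, linarith, simp)
    then have "(numeral pl / numeral D :: real) < numeral (Num.inc j) / numeral w"
      using Suc.prems(2) by linarith
    then have "row_val (row_pos K b w (sinc v) (Num.inc j) n) p = \<lfloor>m * numeral w\<rfloor> - 2 * numeral w"
      using Suc.prems True
      by - (rule Suc.IH[OF Suc.prems(1)], assumption, unfold j1 sval_sinc, linarith+)
    then show ?thesis using True iff by (simp del: sinc.simps rel_code.simps)
  next
    case False
    then have "\<lfloor>m * numeral w\<rfloor> = numeral j - 1" using Suc.prems by linarith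
    then show ?thesis using False iff Suc.prems by (simp del: sinc.simps rel_code.simps)
  qed
qed

lemma row_val_row_neg:
  assumes "w \<le> N" "(numeral pl / numeral D :: real) < numeral j / numeral w"
    and "numeral j + int n \<le> 4 * numeral N + 1"
    and "numeral j \<le> \<lceil>m * numeral w\<rceil>" "\<lceil>m * numeral w\<rceil> \<le> numeral j + int n"
    and "sval v = numeral j - 1 - 2 * numeral w"
  shows "row_val (row_neg K b w v j n) p = 2 * numeral w - \<lceil>m * numeral w\<rceil>"
  using assms
proof (induction n arbitrary: v j)
  case 0
  have "\<lceil>m * numeral w\<rceil> = numeral j" using "0.prems"(4,5) by linarith
  then show ?case
    unfolding row_neg.simps row_val.simps sval_nsum sval.simps "0.prems"(6) numeral_One by linarith
next
  case (Suc n)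
  have jN: "(numeral j :: int) \<le> 4 * numeral N" using Suc.prems(3) by linarith
  have "numeral (num.Bit1 (rel_code K b w j)) \<le> p \<longleftrightarrow> numeral j / numeral w < m"
    by (rule rel_code_le(2)[OF Suc.prems(1,2) jN])
  also have "\<dots> \<longleftrightarrow> of_int (numeral j) < m * numeral w"
    by (simp add: field_simps)
  also have "\<dots> \<longleftrightarrow> numeral j < \<lceil>m * numeral w\<rceil>"
    by (rule less_ceiling_iff[symmetric])
  finally have iff: "numeral (num.Bit1 (rel_code K b w j)) \<le> p \<longleftrightarrow> numeral j < \<lceil>m * numeral w\<rceil>" .
  show ?case
  proof (cases "numeral j < \<lceil>m * numeral w\<rceil>")
    case True
    have j1: "numeral (Num.inc j) = (numeral j + 1 :: int)" by (rule numeral_inc)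
    have j2: "numeral (Num.inc j) = (numeral j + 1 :: real)" by (rule numeral_inc)
    have "(numeral j :: real) / numeral w \<le> numeral (Num.inc j) / numeral w"
      unfolding j2 by (rule divide_right_mono, linarith, simp)
    then have "(numeral pl / numeral D :: real) < numeral (Num.inc j) / numeral w"
      using Suc.prems(2) by linarith
    then have "row_val (row_neg K b w (sinc v) (Num.inc j) n) p = 2 * numeral w - \<lceil>m * numeral w\<rceil>"
      using Suc.prems True
      by - (rule Suc.IH[OF Suc.prems(1)], assumption, unfold j1 sval_sinc, linarith+)
    then show ?thesis using True iff by (simp del: sinc.simps rel_code.simps)
  next
    case False
    then have c: "\<lceil>m * numeral w\<rceil> = numeral j" using Suc.prems by linarith
    have "row_val (row_neg K b w v j (Suc n)) p = sval (nsum v (Pos num.One))"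
      unfolding row_neg.simps row_val.simps iff if_not_P[OF False] ..
    then show ?thesis unfolding sval_nsum sval.simps Suc.prems(6) numeral_One using c by linarith
  qed
qed


text \<open>Side conditions of the two row lemmas. The left end of the cell is excluded, so ceilings
  start at \<open>sval A + 1\<close>; \<open>pr \<le> 4 D\<close> keeps numerators within the range
  of \<open>position\<close>.\<close>

lemma row_bounds:
  assumes "w \<le> N"
  defines "A \<equiv> quo (pl * w) D" and "B \<equiv> quo (pr * w) D"
  shows "numeral (sint_num (sinc A)) = sval A + 1"
    "(numeral pl / numeral D :: real) < numeral (sint_num (sinc A)) / numeral w"
    "numeral (sint_num (sinc A)) + int (sint_nat (ssub B A)) \<le> 4 * numeral N + 1"
    "sval A \<le> \<lfloor>m * numeral w\<rfloor>" "\<lfloor>m * numeral w\<rfloor> \<le> sval A + int (sint_nat (ssub B A))"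
    "sval A + 1 \<le> \<lceil>m * numeral w\<rceil>" "\<lceil>m * numeral w\<rceil> \<le> sval A + 1 + int (sint_nat (ssub B A))"
    "sval (ssub A (Pos (num.Bit0 w))) = sval A - 2 * numeral w"
proof -
  have A: "sval A = \<lfloor>numeral pl / numeral D * numeral w :: real\<rfloor>"
    using floor_divide_of_int_eq[of "numeral (pl * w)" "numeral D", where 'a = real]
    unfolding A_def sval_quo by (simp add: numeral_mult[symmetric])
  have B: "sval B = \<lfloor>numeral pr / numeral D * numeral w :: real\<rfloor>"
    using floor_divide_of_int_eq[of "numeral (pr * w)" "numeral D", where 'a = real]
    unfolding B_def sval_quo by (simp add: numeral_mult[symmetric])
  have lm: "numeral pl / numeral D * numeral w < m * numeral w"
    using m_gt by (intro mult_strict_right_mono) simp_all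
  have mr: "m * numeral w \<le> numeral pr / numeral D * numeral w"
    using m_le by (intro mult_right_mono) simp_all
  have A0: "0 \<le> sval A" unfolding A_def sval_quo
    by (simp only: pos_imp_zdiv_nonneg_iff zero_less_numeral zero_le_numeral)
  have "0 < sval (sinc A)" unfolding sval_sinc using A0 by simp
  then show j: "numeral (sint_num (sinc A)) = sval A + 1"
    using numeral_sint_num sval_sinc by metis
  have AB: "sval A \<le> sval B" unfolding A B using lm mr by (intro floor_mono) linarith
  have n: "int (sint_nat (ssub B A)) = sval B - sval A"
    unfolding sint_nat_eq sval_ssub using AB by simp
  have j': "numeral (sint_num (sinc A)) = (of_int (sval A) + 1 :: real)"
    using arg_cong[OF j, of real_of_int] by simp
  have "numeral pl / numeral D * numeral w < (of_int (sval A) + 1 :: real)"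
    unfolding A by linarith
  then show "(numeral pl / numeral D :: real) < numeral (sint_num (sinc A)) / numeral w"
    unfolding j' by (simp add: pos_less_divide_eq)
  have "numeral pr \<le> (4 * numeral D :: real)"
    using pr[folded numeral_le_iff[where 'a = real]]
    unfolding numeral_Bit0[of "num.Bit0 D"] numeral_Bit0[of D] by linarith
  then have "numeral pr / numeral D * numeral w \<le> (4 * numeral w :: real)"
    by (intro mult_right_mono) (simp_all add: pos_divide_le_eq)
  also have "\<dots> \<le> 4 * numeral N" using assms(1) by (intro mult_left_mono) simp_all
  finally have "\<lfloor>numeral pr / numeral D * numeral w :: real\<rfloor> \<le> \<lfloor>of_int (4 * numeral N) :: real\<rfloor>"
    by (intro floor_mono) simp
  then have "sval B \<le> 4 * numeral N" unfolding B floor_of_int .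
  then show "numeral (sint_num (sinc A)) + int (sint_nat (ssub B A)) \<le> 4 * numeral N + 1"
    unfolding j n by linarith
  show "sval A \<le> \<lfloor>m * numeral w\<rfloor>" unfolding A using lm by (intro floor_mono) linarith
  have "\<lfloor>m * numeral w\<rfloor> \<le> sval B" unfolding B using mr by (rule floor_mono)
  then show "\<lfloor>m * numeral w\<rfloor> \<le> sval A + int (sint_nat (ssub B A))" unfolding n by simp
  show "sval A + 1 \<le> \<lceil>m * numeral w\<rceil>" unfolding A using lm by linarith
  have "\<lceil>m * numeral w\<rceil> \<le> sval B + 1" unfolding B using mr by linarith
  then show "\<lceil>m * numeral w\<rceil> \<le> sval A + 1 + int (sint_nat (ssub B A))" unfolding n by simp
  show "sval (ssub A (Pos (num.Bit0 w))) = sval A - 2 * numeral w"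
    unfolding sval_ssub by simp
qed

lemma row_val_look:
  assumes "look (Cell pl pr D K N b) y \<noteq> Unknown"
  shows "row_val (look (Cell pl pr D K N b) y) p = \<lfloor>(m - 2) * of_int (sval y)\<rfloor>"
proof (cases y)
  case Zer
  then show ?thesis by simp
next
  case (Pos w)
  then have w: "w \<le> N" using assms by (auto split: if_splits)
  note r = row_bounds[OF w]
  have "row_val (look (Cell pl pr D K N b) y) p = \<lfloor>m * numeral w\<rfloor> - 2 * numeral w"
    unfolding Pos look.simps if_P[OF w]
    by (rule row_val_row_pos[OF w r(2,3)]) (use r(1,4-8) in linarith)+
  also have "\<dots> = \<lfloor>m * numeral w - of_int (2 * numeral w)\<rfloor>" by (simp only: floor_diff_of_int)
  also have "m * numeral w - of_int (2 * numeral w) = (m - 2) * of_int (sval y)"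
    unfolding Pos by (simp add: left_diff_distrib)
  finally show ?thesis .
next
  case (Neg w)
  then have w: "w \<le> N" using assms by (auto split: if_splits)
  note r = row_bounds[OF w]
  have "row_val (look (Cell pl pr D K N b) y) p = 2 * numeral w - \<lceil>m * numeral w\<rceil>"
    unfolding Neg look.simps if_P[OF w]
    by (rule row_val_row_neg[OF w r(2,3)]) (use r(1,4-8) in linarith)+
  also have "\<dots> = \<lfloor>- (m * numeral w) + of_int (2 * numeral w)\<rfloor>"
    unfolding floor_add_int[symmetric] floor_minus by linarith
  also have "- (m * numeral w) + of_int (2 * numeral w) = (m - 2) * of_int (sval y)"
    unfolding Neg by (simp add: left_diff_distrib)
  finally show ?thesis .
qed

end

section \<open>From finished walks to periodicity on the whole box\<close>

lemma periodic_of_sat: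
  assumes sat: "sat l (x = y) (x, y) (x, y)"
    and IH: "\<And>s. earlier s (x, y) \<Longrightarrow> s \<noteq> (x, y) \<Longrightarrow> periodic_state l s"
  shows "periodic_state l (x, y)"
proof -
  let ?s = "(x, y)"
  have early: "periodic_state l u \<or> (step l ^^ n) u = ?s" if "earlier ((step l ^^ n) u) ?s" for n u
    using IH[OF that] periodic_of_funpow by blast
  consider n where "n > 0" "earlier ((step l ^^ n) ?s) ?s" | "centred l ?s" "x = y"
    | n where "n > 0" "centred l ?s" "earlier ((step l ^^ n) (prod.swap ?s)) ?s"
    | "centred l ?s" "centred l (prod.swap ?s)"
    using sat unfolding sat_def by blast
  then show ?thesis
  proof cases
    case 1
    then show ?thesis using early[of n ?s] by (auto simp: periodic_state_def)
  next
    case 2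
    then show ?thesis using centred_imp_reflection[of l ?s] by (auto simp: periodic_state_def)
  next
    case 3
    \<comment> \<open>The centre gives a reflection of the start to its swap. If the backward orbit
      reaches the start itself, the two pieces close up to a period; otherwise it reaches a pair
      covered by \<open>IH\<close>.\<close>
    then obtain k where "(step l ^^ k) ?s = prod.swap ?s" using centred_imp_reflection by blast
    then show ?thesis
      using early[OF 3(3)] periodic_swap[of l ?s] periodic_of_reflections[of k l ?s n] 3(1) by blast
  next
    case 4
    then show ?thesis by (rule periodic_of_centred)
  qed
qed

lemma periodic_box:
  assumes "\<And>x y. -10 \<le> x \<Longrightarrow> x \<le> y \<Longrightarrow> y \<le> 10 \<Longrightarrow> sat l (x = y) (x, y) (x, y)"
    and "\<bar>x\<bar> \<le> 10" "\<bar>y\<bar> \<le> 10"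
  shows "periodic_state l (x, y)"
proof -
  \<comment> \<open>Shifted by 10 the entries become digits from 0 to 20, so base 21 turns the
    lexicographic order on sorted pairs into the order of numbers.\<close>
  define key where "key = (\<lambda>s :: int \<times> int.
    nat (21 * (min (fst s) (snd s) + 10) + (max (fst s) (snd s) + 10)))"
  have less_key: "nat (21 * (a + 10) + (b + 10)) < nat (21 * (c + 10) + (d + 10))"
    if "a < c \<or> a = c \<and> b < d" "-10 \<le> a" "-10 \<le> b" "b \<le> 10" "-10 \<le> d" for a b c d :: int
  proof -
    have "21 * (a + 10) + (b + 10) < 21 * (c + 10) + (d + 10)"
      using that by auto
    moreover have "0 \<le> 21 * (a + 10) + (b + 10)" using that(2,3) by auto
    ultimately show ?thesis by simp
  qed
  have "\<bar>fst s\<bar> \<le> 10 \<longrightarrow> \<bar>snd s\<bar> \<le> 10 \<longrightarrow> periodic_state l s" for s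
  proof (induction s rule: measure_induct_rule[of key])
    case (less s)
    obtain u v where s: "s = (u, v)" by fastforce
    show ?case
    proof (intro impI)
      assume h: "\<bar>fst s\<bar> \<le> 10" "\<bar>snd s\<bar> \<le> 10"
      have main: "periodic_state l (a, b)"
        if ab: "a = min u v" "b = max u v" for a b
      proof (rule periodic_of_sat)
        show "sat l (a = b) (a, b) (a, b)"
          using h ab unfolding s by (intro assms(1)) auto
      next
        fix t assume t: "earlier t (a, b)" "t \<noteq> (a, b)"
        then have b: "\<bar>fst t\<bar> \<le> 10" "\<bar>snd t\<bar> \<le> 10" by (auto simp: earlier_def)
        have k: "min (fst t) (snd t) < min u v \<or>
            min (fst t) (snd t) = min u v \<and> max (fst t) (snd t) < max u v"
          using t ab by (auto simp: earlier_def)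
        have bd: "-10 \<le> min (fst t) (snd t)" "-10 \<le> max (fst t) (snd t)" "max (fst t) (snd t) \<le> 10"
          "-10 \<le> max u v" using b h unfolding s by auto
        have "key t < key s"
          unfolding key_def s fst_conv snd_conv using k bd by (rule less_key)
        then show "periodic_state l t" using less.IH b by blast
      qed
      show "periodic_state l s"
      proof (cases "u \<le> v")
        case True
        then show ?thesis using main[of u v] by (simp add: s)
      next
        case False
        then have "periodic_state l (prod.swap s)" using main[of v u] by (simp add: s)
        then show ?thesis by (rule periodic_swap)
      qed
    qed
  qed
  then show ?thesis using assms(2,3) by simp
qed

subsection \<open>Intervals of \<open>\<lambda>\<close> on which the checker succeeds\<close>

definition box_list :: "sint list" where
  "box_list = map Neg [num.Bit0 (num.Bit1 (num.Bit0 num.One)), num.Bit1 (num.Bit0 (num.Bit0 num.One)),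
     num.Bit0 (num.Bit0 (num.Bit0 num.One)), num.Bit1 (num.Bit1 num.One), num.Bit0 (num.Bit1 num.One),
     num.Bit1 (num.Bit0 num.One), num.Bit0 (num.Bit0 num.One), num.Bit1 num.One, num.Bit0 num.One, num.One]
   @ Zer # map Pos [num.One, num.Bit0 num.One, num.Bit1 num.One, num.Bit0 (num.Bit0 num.One),
     num.Bit1 (num.Bit0 num.One), num.Bit0 (num.Bit1 num.One), num.Bit1 (num.Bit1 num.One),
     num.Bit0 (num.Bit0 (num.Bit0 num.One)), num.Bit1 (num.Bit0 (num.Bit0 num.One)),
     num.Bit0 (num.Bit1 (num.Bit0 num.One))]"

fun run_row :: "cell \<Rightarrow> num \<Rightarrow> sint \<Rightarrow> sint list \<Rightarrow> bool" where
  "run_row c t x [] = True"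
| "run_row c t x (y # ys) = (walk c (Env num.One t x y (x = y)) x y \<and> run_row c t x ys)"

text \<open>On an increasing list this visits exactly the pairs with \<open>x \<le> y\<close>; the
  others follow by swapping.\<close>

fun run :: "cell \<Rightarrow> num \<Rightarrow> sint list \<Rightarrow> bool" where
  "run c t [] = True"
| "run c t (x # xs) = (run_row c t x (x # xs) \<and> run c t xs)"

lemma run_row_iff: "run_row c t x ys \<longleftrightarrow> (\<forall>y \<in> set ys. walk c (Env num.One t x y (x = y)) x y)"
  by (induction ys) auto

lemma run_walk:
  assumes "run c t xs" "sorted_wrt (\<lambda>x y. sval x < sval y) xs"
    and "x \<in> set xs" "y \<in> set xs" "sval x \<le> sval y"
  shows "walk c (Env num.One t x y (x = y)) x y"
  using assms
proof (induction xs)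
  case (Cons z zs)
  then show ?case by (fastforce simp: run_row_iff)
qed simp

lemma sval_box_list: "map sval box_list = [-10..10]"
  by (simp add: box_list_def upto_rec1)

lemma sorted_box_list: "sorted_wrt (\<lambda>x y. sval x < sval y) box_list"
  by (simp add: box_list_def)

lemma box_list_ex: "-10 \<le> k \<Longrightarrow> k \<le> 10 \<Longrightarrow> \<exists>x \<in> set box_list. sval x = k"
proof -
  assume "-10 \<le> k" "k \<le> 10"
  then have "k \<in> set [-10..10]" by (simp only: set_upto atLeastAtMost_iff)
  then show ?thesis unfolding sval_box_list[symmetric] by auto
qed

definition covers :: "real set \<Rightarrow> bool" where
  "covers A \<longleftrightarrow> (\<forall>m \<in> A. \<forall>x y. \<bar>x\<bar> \<le> 10 \<longrightarrow> \<bar>y\<bar> \<le> 10 \<longrightarrow> periodic_state (m - 2) (x, y))"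

lemma run_periodic:
  assumes K: "N * N \<le> K" and D: "D \<le> N" and pr: "pr \<le> num.Bit0 (num.Bit0 D)"
    and b: "quo (K * pl) D = Pos b"
    and m_gt: "numeral pl / numeral D < m" and m_le: "m \<le> numeral pr / numeral D"
    and t: "t = num.Bit1 (rel_code K b D pr) \<or>
      t = num.Bit0 (rel_code K b D pr) \<and> m \<noteq> numeral pr / numeral D"
    and run: "run (Cell pl pr D K N b) t box_list"
    and box: "\<bar>x\<bar> \<le> 10" "\<bar>y\<bar> \<le> 10"
  shows "periodic_state (m - 2) (x, y)"
proof -
  have "0 < numeral pl / (numeral D :: real)" by simp
  then have "0 \<le> m" using m_gt by linarith
  then obtain q where q: "position (numeral K) (numeral N) m q"
    using position_exists[OF numeral_square_le[OF K]] by auto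
  define p where "p = q - 2 * numeral b"
  have pos: "position (numeral K) (numeral N) m (p + 2 * numeral b)"
    using q by (simp add: p_def)
  have pr4: "(numeral pr :: int) \<le> 4 * numeral D"
    using pr[folded numeral_le_iff[where 'a = int]]
    unfolding numeral_Bit0[of "num.Bit0 D"] numeral_Bit0[of D] by linarith
  have "(numeral D :: int) \<le> numeral N" using D by simp
  then have pr': "(numeral pr :: int) \<le> 4 * numeral N" using pr4 by linarith
  have lr: "(numeral pl / numeral D :: real) < numeral pr / numeral D"
    using m_gt m_le by linarith
  have "(numeral pl :: real) < numeral pr"
  proof (rule ccontr)
    assume "\<not> (numeral pl :: real) < numeral pr"
    then have "(numeral pr / numeral D :: real) \<le> numeral pl / numeral D"
      by - (rule divide_right_mono, linarith, simp)
    then show False using lr by linarith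
  qed
  then have "numeral pl \<le> (numeral pr :: int)"
    by (simp only: numeral_less_iff numeral_le_iff less_imp_le)
  then have pl': "(numeral pl :: int) \<le> 4 * numeral N" using pr' by linarith
  have "of_int (numeral pl) / of_int (numeral D) < m \<longleftrightarrow>
      2 * (numeral K * numeral pl div numeral D) + 1 \<le> q"
    using q pl' D unfolding position_def by (simp only: zero_le_numeral zero_less_numeral numeral_le_iff)
  \<comment> \<open>The left end of the cell has relative position 0, and \<open>m\<close> lies
    strictly beyond it.\<close>
  then have p1: "numeral num.One \<le> p"
    using m_gt numeral_b[OF K D pr b m_gt m_le pos] unfolding p_def of_int_numeral numeral_One by linarith
  \<comment> \<open>The bound \<open>t\<close> is exclusive: an odd code still admits
    \<open>m = pr / D\<close>, an even one stops before it.\<close>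
  have pt: "p < numeral t"
    using t rel_code_le[OF K D pr b m_gt m_le pos D lr pr'] m_le by (auto simp: not_le)
  have tab: "row_val (look (Cell pl pr D K N b) y) p = \<lfloor>(m - 2) * of_int (sval y)\<rfloor>"
    if "look (Cell pl pr D K N b) y \<noteq> Unknown" for y
    using row_val_look[OF K D pr b m_gt m_le pos that] .
  have "sat (m - 2) (u = v) (u, v) (u, v)" if uv: "-10 \<le> u" "u \<le> v" "v \<le> 10" for u v
  proof -
    obtain x y where xy: "x \<in> set box_list" "y \<in> set box_list" "sval x = u" "sval y = v"
      using box_list_ex[of u] box_list_ex[of v] uv by auto
    have "walk (Cell pl pr D K N b) (Env num.One t x y (x = y)) x y"
      using run_walk[OF run sorted_box_list xy(1,2)] xy uv by simp
    then have "sat (m - 2) (x = y) (sval x, sval y) (sval x, sval y)"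
      using walk_sound(1)[OF tab] p1 pt xy uv by blast
    moreover have "x = y \<Longrightarrow> u = v" using xy by auto
    ultimately show ?thesis unfolding sat_def xy by blast
  qed
  then show ?thesis using box by (rule periodic_box)
qed

definition num_of :: "int \<Rightarrow> num" where
  "num_of k = num_of_nat (nat k)"

lemma num_of_simps: "num_of (numeral n) = n" "num_of 1 = num.One"
  by (simp_all add: num_of_def nat_of_num_inverse flip: nat_of_num_numeral)

text \<open>\<open>cell_of l r d n\<close> stands for \<open>\<mu> = \<lambda> + 2\<close> between \<open>l / d\<close> and \<open>r / d\<close>, with rows for
  \<open>\<bar>y\<bar> \<le> n\<close>.\<close>

definition cell_of :: "int \<Rightarrow> int \<Rightarrow> int \<Rightarrow> int \<Rightarrow> cell" where
  "cell_of l r d n = Cell (num_of l) (num_of r) (num_of d) (num_of n * num_of n) (num_of n)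
     (sint_num (quo (num_of n * num_of n * num_of l) (num_of d)))"

fun valid_cell :: "cell \<Rightarrow> bool" where
  "valid_cell (Cell pl pr D K N b) \<longleftrightarrow> D \<le> N \<and> pr \<le> num.Bit0 (num.Bit0 D) \<and> quo (K * pl) D = Pos b"

fun top_closed :: "cell \<Rightarrow> num" where
  "top_closed (Cell pl pr D K N b) = num.Bit1 (rel_code K b D pr)"

fun top_open :: "cell \<Rightarrow> num" where
  "top_open (Cell pl pr D K N b) = num.Bit0 (rel_code K b D pr)"

lemma numeral_num_of: "0 < k \<Longrightarrow> numeral (num_of k) = (of_int k :: real)"
proof -
  assume "0 < k"
  then have n: "nat_of_num (num_of k) = nat k" by (simp add: num_of_def num_of_nat_inverse)
  have "(numeral (num_of k) :: real) = of_nat (nat_of_num (num_of k))"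
    by (simp only: nat_of_num_numeral of_nat_numeral)
  then show ?thesis using \<open>0 < k\<close> by (simp add: n)
qed

text \<open>The cell enters twice: as \<open>c\<close>, which stays opaque while its rows serve as
  rewrite rules, and through its parameters, from which validity and the upper end are
  computed.\<close>

definition closed_run :: "cell \<Rightarrow> int \<Rightarrow> int \<Rightarrow> int \<Rightarrow> int \<Rightarrow> bool" where
  "closed_run c l r d n \<longleftrightarrow>
    valid_cell (cell_of l r d n) \<and> run c (top_closed (cell_of l r d n)) box_list"

definition open_run :: "cell \<Rightarrow> int \<Rightarrow> int \<Rightarrow> int \<Rightarrow> int \<Rightarrow> bool" where
  "open_run c l r d n \<longleftrightarrow>
    valid_cell (cell_of l r d n) \<and> run c (top_open (cell_of l r d n)) box_list"

lemma covers_append [trans]: "covers {a<..b} \<Longrightarrow> covers {b<..c} \<Longrightarrow> covers {a<..c}"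
  unfolding covers_def by (metis greaterThanAtMost_iff not_le)

lemma covers_append_open: "covers {a<..b} \<Longrightarrow> covers {b<..<c} \<Longrightarrow> covers {a<..<c}"
  unfolding covers_def by (metis greaterThanAtMost_iff greaterThanLessThan_iff not_le)

lemma covers_closed:
  assumes "closed_run (cell_of l r d n) l r d n" and "0 < l" "0 < r" "0 < d"
  shows "covers {of_int l / of_int d<..of_int r / of_int d}"
  unfolding covers_def
proof (intro ballI allI impI)
  fix m :: real and x y :: int
  assume m: "m \<in> {of_int l / of_int d<..of_int r / of_int d}" and xy: "\<bar>x\<bar> \<le> 10" "\<bar>y\<bar> \<le> 10"
  note v = assms(1)[unfolded closed_run_def cell_of_def valid_cell.simps top_closed.simps]
  show "periodic_state (m - 2) (x, y)"
    by (rule run_periodic[OF order.refl _ _ _ _ _ _ v[THEN conjunct2] xy])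
      (use v m in \<open>auto simp only: numeral_num_of assms(2-4) greaterThanAtMost_iff\<close>)
qed

lemma covers_open:
  assumes "open_run (cell_of l r d n) l r d n" and "0 < l" "0 < r" "0 < d"
  shows "covers {of_int l / of_int d<..<of_int r / of_int d}"
  unfolding covers_def
proof (intro ballI allI impI)
  fix m :: real and x y :: int
  assume m: "m \<in> {of_int l / of_int d<..<of_int r / of_int d}" and xy: "\<bar>x\<bar> \<le> 10" "\<bar>y\<bar> \<le> 10"
  note v = assms(1)[unfolded open_run_def cell_of_def valid_cell.simps top_open.simps]
  show "periodic_state (m - 2) (x, y)"
    by (rule run_periodic[OF order.refl _ _ _ _ _ _ v[THEN conjunct2] xy])
      (use v m in \<open>auto simp only: numeral_num_of assms(2-4) greaterThanLessThan_iff less_imp_le\<close>)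
qed

subsection \<open>Evaluation by rewriting\<close>

text \<open>The rows of a cell, listed as one conjunction whose conjuncts serve as rewrite rules
  for the opaque constant \<open>c\<close>; rewriting then never has to carry the table along.\<close>

fun table :: "cell \<Rightarrow> num \<Rightarrow> nat \<Rightarrow> num \<Rightarrow> cell \<Rightarrow> bool"
  and table_from :: "cell \<Rightarrow> num \<Rightarrow> nat \<Rightarrow> num \<Rightarrow> cell \<Rightarrow> bool \<Rightarrow> bool" where
  "table c N 0 w d = True"
| "table c N (Suc k) w d = table_from c N k w d (w \<le> N)"
| "table_from c N k w d False = True"
| "table_from c N k w d True = (look c (Pos w) = look d (Pos w) \<and> look c (Neg w) = look d (Neg w) \<and>
     table c N k (num.Bit0 w) d \<and> table c N k (num.Bit1 w) d)"

lemma table_refl: "table c N k w c" "table_from c N k w c t"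
  by (induction c N k w c and c N k w c t rule: table_table_from.induct) auto

text \<open>The table is a binary tree of numerals cut off above \<open>n\<close>. Nine levels reach
  all numbers below 512, and the largest orbit bound below is 440.\<close>

lemma table_cell:
  assumes "c = cell_of l r d n"
  shows "look c Zer = Lf Zer \<and>
    table c (num_of n) (Suc (Suc (Suc (Suc (Suc (Suc (Suc (Suc (Suc 0))))))))) num.One (cell_of l r d n)"
  unfolding assms by (simp only: table_refl simp_thms) (simp add: cell_of_def)

lemmas arith_rules = sdup.simps sdup_inc.simps sdup_dec.simps ndiff.simps nsum.simps sneg.simps
  add_num_simps BitM.simps le_num_simps less_num_simps num.inject num.distinct sint.inject
  sint.distinct simp_thms

lemmas table_rules = arith_rules mult_num_simps num_of_simps cell_of_def table.simps
  table_from.simps look.simps row_pos.simps row_neg.simps rel_code.simps sinc.simps ssub.simps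
  sint_num.simps sint_nat.simps nat_of_num.simps add_0 add_Suc sub_num.simps div_step.simps
  div_even.simps div_odd.simps div_num.simps quo.simps fst_conv inc.simps if_True if_False

lemmas walk_rules = arith_rules walk_eqs in_box.simps le_ten.simps verdict0.simps verdict1.simps
  verdict2.simps verdict3.simps earlier_aux.simps lex_less.simps sless.simps run.simps
  run_row.simps closed_run_def open_run_def valid_cell.simps top_closed.simps top_open.simps
  box_list_def list.map append.simps

subsection \<open>The cells\<close>

text \<open>The last parameter of each cell is a bound for the orbits, found by computing them in advance.\<close>

lemma cell_1_240:
  assumes "c = cell_of 1 2 240 440"
  shows "closed_run c 1 2 240 440"
  \<comment> \<open>The table is first normalised to explicit rows for \<open>c\<close>; all walks
    are then evaluated with these.\<close>
  by (simp only: table_cell[OF assms, simplified table_rules] walk_rules table_rules)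

lemma cell_1_120:
  assumes "c = cell_of 1 2 120 278"
  shows "closed_run c 1 2 120 278"
  by (simp only: table_cell[OF assms, simplified table_rules] walk_rules table_rules)

lemma cell_2_120:
  assumes "c = cell_of 2 3 120 198"
  shows "closed_run c 2 3 120 198"
  by (simp only: table_cell[OF assms, simplified table_rules] walk_rules table_rules)

lemma cell_1_40:
  assumes "c = cell_of 1 2 40 158"
  shows "closed_run c 1 2 40 158"
  by (simp only: table_cell[OF assms, simplified table_rules] walk_rules table_rules)

lemma cell_1_20:
  assumes "c = cell_of 1 2 20 115"
  shows "closed_run c 1 2 20 115"
  by (simp only: table_cell[OF assms, simplified table_rules] walk_rules table_rules)

lemma cell_2_20:
  assumes "c = cell_of 2 3 20 97"
  shows "closed_run c 2 3 20 97"
  by (simp only: table_cell[OF assms, simplified table_rules] walk_rules table_rules)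

lemma cell_3_20:
  assumes "c = cell_of 3 4 20 64"
  shows "closed_run c 3 4 20 64"
  by (simp only: table_cell[OF assms, simplified table_rules] walk_rules table_rules)

lemma cell_4_20:
  assumes "c = cell_of 4 5 20 52"
  shows "closed_run c 4 5 20 52"
  by (simp only: table_cell[OF assms, simplified table_rules] walk_rules table_rules)

lemma cell_5_20:
  assumes "c = cell_of 5 6 20 47"
  shows "closed_run c 5 6 20 47"
  by (simp only: table_cell[OF assms, simplified table_rules] walk_rules table_rules)

lemma cell_6_20:
  assumes "c = cell_of 6 7 20 48"
  shows "closed_run c 6 7 20 48"
  by (simp only: table_cell[OF assms, simplified table_rules] walk_rules table_rules)

lemma cell_7_20:
  assumes "c = cell_of 7 8 20 38"
  shows "closed_run c 7 8 20 38"
  by (simp only: table_cell[OF assms, simplified table_rules] walk_rules table_rules)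

lemma cell_8_20:
  assumes "c = cell_of 8 9 20 39"
  shows "closed_run c 8 9 20 39"
  by (simp only: table_cell[OF assms, simplified table_rules] walk_rules table_rules)

lemma cell_9_20:
  assumes "c = cell_of 9 10 20 34"
  shows "closed_run c 9 10 20 34"
  by (simp only: table_cell[OF assms, simplified table_rules] walk_rules table_rules)

lemma cell_5_10:
  assumes "c = cell_of 5 6 10 33"
  shows "closed_run c 5 6 10 33"
  by (simp only: table_cell[OF assms, simplified table_rules] walk_rules table_rules)

lemma cell_6_10:
  assumes "c = cell_of 6 7 10 31"
  shows "closed_run c 6 7 10 31"
  by (simp only: table_cell[OF assms, simplified table_rules] walk_rules table_rules)

lemma cell_7_10:
  assumes "c = cell_of 7 8 10 27"
  shows "closed_run c 7 8 10 27"
  by (simp only: table_cell[OF assms, simplified table_rules] walk_rules table_rules)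

lemma cell_8_10:
  assumes "c = cell_of 8 9 10 26"
  shows "closed_run c 8 9 10 26"
  by (simp only: table_cell[OF assms, simplified table_rules] walk_rules table_rules)

lemma cell_9_10:
  assumes "c = cell_of 9 10 10 23"
  shows "closed_run c 9 10 10 23"
  by (simp only: table_cell[OF assms, simplified table_rules] walk_rules table_rules)

lemma cell_5_5:
  assumes "c = cell_of 5 6 5 22"
  shows "closed_run c 5 6 5 22"
  by (simp only: table_cell[OF assms, simplified table_rules] walk_rules table_rules)

lemma cell_6_5:
  assumes "c = cell_of 6 7 5 26"
  shows "closed_run c 6 7 5 26"
  by (simp only: table_cell[OF assms, simplified table_rules] walk_rules table_rules)

lemma cell_7_5:
  assumes "c = cell_of 7 8 5 19"
  shows "closed_run c 7 8 5 19"
  by (simp only: table_cell[OF assms, simplified table_rules] walk_rules table_rules)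

lemma cell_8_5:
  assumes "c = cell_of 8 9 5 19"
  shows "closed_run c 8 9 5 19"
  by (simp only: table_cell[OF assms, simplified table_rules] walk_rules table_rules)

lemma cell_9_5:
  assumes "c = cell_of 9 10 5 20"
  shows "closed_run c 9 10 5 20"
  by (simp only: table_cell[OF assms, simplified table_rules] walk_rules table_rules)

lemma cell_10_5:
  assumes "c = cell_of 10 11 5 20"
  shows "closed_run c 10 11 5 20"
  by (simp only: table_cell[OF assms, simplified table_rules] walk_rules table_rules)

lemma cell_11_5:
  assumes "c = cell_of 11 12 5 23"
  shows "closed_run c 11 12 5 23"
  by (simp only: table_cell[OF assms, simplified table_rules] walk_rules table_rules)

lemma cell_12_5:
  assumes "c = cell_of 12 13 5 21"
  shows "closed_run c 12 13 5 21"
  by (simp only: table_cell[OF assms, simplified table_rules] walk_rules table_rules)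

lemma cell_13_5:
  assumes "c = cell_of 13 14 5 45"
  shows "closed_run c 13 14 5 45"
  by (simp only: table_cell[OF assms, simplified table_rules] walk_rules table_rules)

lemma cell_14_5:
  assumes "c = cell_of 14 15 5 24"
  shows "closed_run c 14 15 5 24"
  by (simp only: table_cell[OF assms, simplified table_rules] walk_rules table_rules)

lemma cell_30_10:
  assumes "c = cell_of 30 31 10 24"
  shows "closed_run c 30 31 10 24"
  by (simp only: table_cell[OF assms, simplified table_rules] walk_rules table_rules)

lemma cell_31_10:
  assumes "c = cell_of 31 32 10 28"
  shows "closed_run c 31 32 10 28"
  by (simp only: table_cell[OF assms, simplified table_rules] walk_rules table_rules)

lemma cell_32_10:
  assumes "c = cell_of 32 33 10 29"
  shows "closed_run c 32 33 10 29"
  by (simp only: table_cell[OF assms, simplified table_rules] walk_rules table_rules)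

lemma cell_33_10:
  assumes "c = cell_of 33 34 10 34"
  shows "closed_run c 33 34 10 34"
  by (simp only: table_cell[OF assms, simplified table_rules] walk_rules table_rules)

lemma cell_34_10:
  assumes "c = cell_of 34 35 10 36"
  shows "closed_run c 34 35 10 36"
  by (simp only: table_cell[OF assms, simplified table_rules] walk_rules table_rules)

lemma cell_35_10:
  assumes "c = cell_of 35 36 10 46"
  shows "closed_run c 35 36 10 46"
  by (simp only: table_cell[OF assms, simplified table_rules] walk_rules table_rules)

lemma cell_36_10:
  assumes "c = cell_of 36 37 10 53"
  shows "closed_run c 36 37 10 53"
  by (simp only: table_cell[OF assms, simplified table_rules] walk_rules table_rules)

lemma cell_74_20:
  assumes "c = cell_of 74 75 20 50"
  shows "closed_run c 74 75 20 50"
  by (simp only: table_cell[OF assms, simplified table_rules] walk_rules table_rules)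

lemma cell_75_20:
  assumes "c = cell_of 75 76 20 57"
  shows "closed_run c 75 76 20 57"
  by (simp only: table_cell[OF assms, simplified table_rules] walk_rules table_rules)

lemma cell_76_20:
  assumes "c = cell_of 76 77 20 70"
  shows "closed_run c 76 77 20 70"
  by (simp only: table_cell[OF assms, simplified table_rules] walk_rules table_rules)

lemma cell_77_20:
  assumes "c = cell_of 77 78 20 127"
  shows "closed_run c 77 78 20 127"
  by (simp only: table_cell[OF assms, simplified table_rules] walk_rules table_rules)

text \<open>Towards 4 the orbit bounds rise again; the narrower cells limit the number of thresholds
  per row.\<close>

lemma cell_390_100:
  assumes "c = cell_of 390 391 100 102"
  shows "closed_run c 390 391 100 102"
  by (simp only: table_cell[OF assms, simplified table_rules] walk_rules table_rules)

lemma cell_391_100: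
  assumes "c = cell_of 391 392 100 111"
  shows "closed_run c 391 392 100 111"
  by (simp only: table_cell[OF assms, simplified table_rules] walk_rules table_rules)

lemma cell_392_100:
  assumes "c = cell_of 392 393 100 100"
  shows "closed_run c 392 393 100 100"
  by (simp only: table_cell[OF assms, simplified table_rules] walk_rules table_rules)

lemma cell_393_100:
  assumes "c = cell_of 393 394 100 126"
  shows "closed_run c 393 394 100 126"
  by (simp only: table_cell[OF assms, simplified table_rules] walk_rules table_rules)

lemma cell_394_100:
  assumes "c = cell_of 394 395 100 127"
  shows "closed_run c 394 395 100 127"
  by (simp only: table_cell[OF assms, simplified table_rules] walk_rules table_rules)

lemma cell_395_100:
  assumes "c = cell_of 395 396 100 147"
  shows "closed_run c 395 396 100 147"
  by (simp only: table_cell[OF assms, simplified table_rules] walk_rules table_rules)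

lemma cell_396_100:
  assumes "c = cell_of 396 397 100 138"
  shows "closed_run c 396 397 100 138"
  by (simp only: table_cell[OF assms, simplified table_rules] walk_rules table_rules)

lemma cell_397_100:
  assumes "c = cell_of 397 398 100 162"
  shows "closed_run c 397 398 100 162"
  by (simp only: table_cell[OF assms, simplified table_rules] walk_rules table_rules)

lemma cell_796_200:
  assumes "c = cell_of 796 797 200 200"
  shows "closed_run c 796 797 200 200"
  by (simp only: table_cell[OF assms, simplified table_rules] walk_rules table_rules)

lemma cell_797_200:
  assumes "c = cell_of 797 798 200 224"
  shows "closed_run c 797 798 200 224"
  by (simp only: table_cell[OF assms, simplified table_rules] walk_rules table_rules)

lemma cell_798_200:
  assumes "c = cell_of 798 799 200 285"
  shows "closed_run c 798 799 200 285"
  by (simp only: table_cell[OF assms, simplified table_rules] walk_rules table_rules)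

lemma cell_1598_400:
  assumes "c = cell_of 1598 1599 400 419"
  shows "closed_run c 1598 1599 400 419"
  by (simp only: table_cell[OF assms, simplified table_rules] walk_rules table_rules)

text \<open>The last cell is open on the right: at \<open>\<lambda> = 2\<close> there are unbounded
  orbits such as \<open>(-1)^n * n\<close>.\<close>

lemma cell_1599_400:
  assumes "c = cell_of 1599 1600 400 414"
  shows "open_run c 1599 1600 400 414"
  by (simp only: table_cell[OF assms, simplified table_rules] walk_rules table_rules)

lemma covers_main: "covers {1 / 240<..<4}"
proof -
  have "covers {1 / 240<..1 / 120}"
    using covers_closed[OF cell_1_240[OF refl]] by simp
  also have "covers {1 / 120<..1 / 60}"
    using covers_closed[OF cell_1_120[OF refl]] by simp
  also have "covers {1 / 60<..1 / 40}"
    using covers_closed[OF cell_2_120[OF refl]] by simp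
  also have "covers {1 / 40<..1 / 20}"
    using covers_closed[OF cell_1_40[OF refl]] by simp
  also have "covers {1 / 20<..1 / 10}"
    using covers_closed[OF cell_1_20[OF refl]] by simp
  also have "covers {1 / 10<..3 / 20}"
    using covers_closed[OF cell_2_20[OF refl]] by simp
  also have "covers {3 / 20<..1 / 5}"
    using covers_closed[OF cell_3_20[OF refl]] by simp
  also have "covers {1 / 5<..1 / 4}"
    using covers_closed[OF cell_4_20[OF refl]] by simp
  also have "covers {1 / 4<..3 / 10}"
    using covers_closed[OF cell_5_20[OF refl]] by simp
  also have "covers {3 / 10<..7 / 20}"
    using covers_closed[OF cell_6_20[OF refl]] by simp
  also have "covers {7 / 20<..2 / 5}"
    using covers_closed[OF cell_7_20[OF refl]] by simp
  also have "covers {2 / 5<..9 / 20}"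
    using covers_closed[OF cell_8_20[OF refl]] by simp
  also have "covers {9 / 20<..1 / 2}"
    using covers_closed[OF cell_9_20[OF refl]] by simp
  also have "covers {1 / 2<..3 / 5}"
    using covers_closed[OF cell_5_10[OF refl]] by simp
  also have "covers {3 / 5<..7 / 10}"
    using covers_closed[OF cell_6_10[OF refl]] by simp
  also have "covers {7 / 10<..4 / 5}"
    using covers_closed[OF cell_7_10[OF refl]] by simp
  also have "covers {4 / 5<..9 / 10}"
    using covers_closed[OF cell_8_10[OF refl]] by simp
  also have "covers {9 / 10<..1}"
    using covers_closed[OF cell_9_10[OF refl]] by simp
  also have "covers {1<..6 / 5}"
    using covers_closed[OF cell_5_5[OF refl]] by simp
  also have "covers {6 / 5<..7 / 5}"
    using covers_closed[OF cell_6_5[OF refl]] by simp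
  also have "covers {7 / 5<..8 / 5}"
    using covers_closed[OF cell_7_5[OF refl]] by simp
  also have "covers {8 / 5<..9 / 5}"
    using covers_closed[OF cell_8_5[OF refl]] by simp
  also have "covers {9 / 5<..2}"
    using covers_closed[OF cell_9_5[OF refl]] by simp
  also have "covers {2<..11 / 5}"
    using covers_closed[OF cell_10_5[OF refl]] by simp
  also have "covers {11 / 5<..12 / 5}"
    using covers_closed[OF cell_11_5[OF refl]] by simp
  also have "covers {12 / 5<..13 / 5}"
    using covers_closed[OF cell_12_5[OF refl]] by simp
  also have "covers {13 / 5<..14 / 5}"
    using covers_closed[OF cell_13_5[OF refl]] by simp
  also have "covers {14 / 5<..3}"
    using covers_closed[OF cell_14_5[OF refl]] by simp
  also have "covers {3<..31 / 10}"
    using covers_closed[OF cell_30_10[OF refl]] by simp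
  also have "covers {31 / 10<..16 / 5}"
    using covers_closed[OF cell_31_10[OF refl]] by simp
  also have "covers {16 / 5<..33 / 10}"
    using covers_closed[OF cell_32_10[OF refl]] by simp
  also have "covers {33 / 10<..17 / 5}"
    using covers_closed[OF cell_33_10[OF refl]] by simp
  also have "covers {17 / 5<..7 / 2}"
    using covers_closed[OF cell_34_10[OF refl]] by simp
  also have "covers {7 / 2<..18 / 5}"
    using covers_closed[OF cell_35_10[OF refl]] by simp
  also have "covers {18 / 5<..37 / 10}"
    using covers_closed[OF cell_36_10[OF refl]] by simp
  also have "covers {37 / 10<..15 / 4}"
    using covers_closed[OF cell_74_20[OF refl]] by simp
  also have "covers {15 / 4<..19 / 5}"
    using covers_closed[OF cell_75_20[OF refl]] by simp
  also have "covers {19 / 5<..77 / 20}"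
    using covers_closed[OF cell_76_20[OF refl]] by simp
  also have "covers {77 / 20<..39 / 10}"
    using covers_closed[OF cell_77_20[OF refl]] by simp
  also have "covers {39 / 10<..391 / 100}"
    using covers_closed[OF cell_390_100[OF refl]] by simp
  also have "covers {391 / 100<..98 / 25}"
    using covers_closed[OF cell_391_100[OF refl]] by simp
  also have "covers {98 / 25<..393 / 100}"
    using covers_closed[OF cell_392_100[OF refl]] by simp
  also have "covers {393 / 100<..197 / 50}"
    using covers_closed[OF cell_393_100[OF refl]] by simp
  also have "covers {197 / 50<..79 / 20}"
    using covers_closed[OF cell_394_100[OF refl]] by simp
  also have "covers {79 / 20<..99 / 25}"
    using covers_closed[OF cell_395_100[OF refl]] by simp
  also have "covers {99 / 25<..397 / 100}"
    using covers_closed[OF cell_396_100[OF refl]] by simp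
  also have "covers {397 / 100<..199 / 50}"
    using covers_closed[OF cell_397_100[OF refl]] by simp
  also have "covers {199 / 50<..797 / 200}"
    using covers_closed[OF cell_796_200[OF refl]] by simp
  also have "covers {797 / 200<..399 / 100}"
    using covers_closed[OF cell_797_200[OF refl]] by simp
  also have "covers {399 / 100<..799 / 200}"
    using covers_closed[OF cell_798_200[OF refl]] by simp
  also have "covers {799 / 200<..1599 / 400}"
    using covers_closed[OF cell_1598_400[OF refl]] by simp
  finally have "covers {1 / 240<..1599 / 400}" .
  moreover have "covers {1599 / 400<..<4}"
    using covers_open[OF cell_1599_400[OF refl]] by simp
  ultimately show ?thesis by (rule covers_append_open)
qed

lemma covers_all: "covers {0<..<4}"
proof -
  have "covers {0<..1 / 240}"
    unfolding covers_def using periodic_box_near by auto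
  then show ?thesis using covers_main by (rule covers_append_open)
qed

theorem theorem3:
  fixes a :: "nat \<Rightarrow> int" and lam :: real
  assumes "max \<bar>a 0\<bar> \<bar>a 1\<bar> \<le> 10"
    and "lam \<in> {-2<..<2}"
    and "\<And>n. 0 \<le> of_int (a (n + 2)) + lam * of_int (a (n + 1)) + of_int (a n)
           \<and> of_int (a (n + 2)) + lam * of_int (a (n + 1)) + of_int (a n) < 1"
  shows "\<exists>p>0. \<forall>n. a (n + p) = a n"
proof -
  have step: "step lam (a n, a (n + 1)) = (a (n + 1), a (n + 2))" for n
  proof -
    \<comment> \<open>The two given inequalities are exactly the bounds that characterise this
      floor.\<close>
    have "\<lfloor>lam * of_int (a (n + 1))\<rfloor> = - a (n + 2) - a n"
      using assms(3)[of n] by (intro floor_unique) auto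
    then show ?thesis by (simp add: step_def)
  qed
  have orbit: "(step lam ^^ n) (a k, a (k + 1)) = (a (k + n), a (k + n + 1))" for n k
  proof (induction n)
    case (Suc n)
    then show ?case using step[of "k + n"] by simp
  qed simp
  have "lam + 2 \<in> {0<..<4}" using assms(2) by auto
  then have "periodic_state (lam + 2 - 2) (a 0, a 1)"
    using covers_all assms(1) unfolding covers_def by fastforce
  then obtain p where p: "p > 0" "(step lam ^^ p) (a 0, a (0 + 1)) = (a 0, a 1)"
    by (auto simp: periodic_state_def)
  have "a (n + p) = a n" for n
  proof -
    have "(a (n + p), a (n + p + 1)) = (step lam ^^ n) ((step lam ^^ p) (a 0, a (0 + 1)))"
      unfolding orbit by (simp add: orbit[of n p, simplified] add.commute)
    also have "\<dots> = (a n, a (n + 1))"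
      unfolding p(2) using orbit[of n 0] by simp
    finally show ?thesis by simp
  qed
  then show ?thesis using p(1) by blast
qed

end
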